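(* Let $C$ be an algebraically closed field of characteristic zero with the trivial derivation ($c'=0$ for all $c\in C$). Let $P(X)\in C[X]$ be a polynomial of degree $\geq 3$ with no repeated roots. Then the differential equation $(Y')^2=P(Y)$ has no non constant liouvillian solution over $C$. In particular, if $a,b\in C$ satisfy $\frac{a^3}{27}+\frac{b^2}{4}\neq 0$, then a non constant element $y$ (an elliptic function) such that $(y')^2=y^3+ay+b$ is not liouvillian over $C$.
   Context: A differential field is a field with a derivation $'$. A differential field extension $E$ of $C$ is a liouvillian extension of $C$ if $E=C(t_1,\dots,t_n)$ and there is a tower of differential fields $C=k_0\subset k_1\subset\cdots\subset k_n=E$ such that for each $i$, $k_i=k_{i-1}(t_i)$ and either $t_i'\in k_{i-1}$, or $t_i'/t_i\in k_{i-1}$ (with $t_i\neq 0$), or $t_i$ is algebraic over $k_{i-1}$. A solution of a differential equation is liouvillian over $C$ if it belongs to some liouvillian extension of $C$; it is non constant if its derivative is nonzero. *)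

theory Defs
  imports "HOL-Computational_Algebra.Computational_Algebra"
begin

locale differential_field =
  fixes deriv :: "'a::field \<Rightarrow> 'a"
  assumes deriv_add: "deriv (x + y) = deriv x + deriv y"
    and deriv_mult: "deriv (x * y) = deriv x * y + x * deriv y"

text \<open>
  An extension of differential fields is given by a ring homomorphism \<open>\<iota>\<close> (automatically
  injective) that commutes with the derivations; the base field is then identified with
  \<open>range \<iota>\<close>.
\<close>

locale differential_field_extension =
  base: differential_field dC + ext: differential_field dF
  for dC :: "'c::field \<Rightarrow> 'c" and dF :: "'f::field \<Rightarrow> 'f" +
  fixes \<iota> :: "'c \<Rightarrow> 'f"
  assumes embed_one: "\<iota> 1 = 1"
    and embed_add: "\<iota> (x + y) = \<iota> x + \<iota> y"
    and embed_mult: "\<iota> (x * y) = \<iota> x * \<iota> y"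
    and embed_deriv: "\<iota> (dC x) = dF (\<iota> x)"

definition is_subfield :: "'f::field set \<Rightarrow> bool" where
  "is_subfield K \<longleftrightarrow> 0 \<in> K \<and> 1 \<in> K \<and>
     (\<forall>x\<in>K. \<forall>y\<in>K. x + y \<in> K \<and> x * y \<in> K) \<and>
     (\<forall>x\<in>K. - x \<in> K \<and> inverse x \<in> K)"

definition is_differential_subfield :: "('f::field \<Rightarrow> 'f) \<Rightarrow> 'f set \<Rightarrow> bool" where
  "is_differential_subfield d K \<longleftrightarrow> is_subfield K \<and> (\<forall>x\<in>K. d x \<in> K)"

definition adjoin :: "'f::field set \<Rightarrow> 'f set \<Rightarrow> 'f set" where
  "adjoin K T = is_subfield hull (K \<union> T)"

definition algebraic_over :: "'f::field set \<Rightarrow> 'f \<Rightarrow> bool" where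
  "algebraic_over K x \<longleftrightarrow> (\<exists>p. p \<noteq> 0 \<and> (\<forall>i. coeff p i \<in> K) \<and> poly p x = 0)"

text \<open>
  Here \<open>C\<close> and \<open>E\<close> are subfields of one differential field with derivation \<open>d\<close>.
\<close>

definition liouvillian_extension :: "('f::field \<Rightarrow> 'f) \<Rightarrow> 'f set \<Rightarrow> 'f set \<Rightarrow> bool" where
  "liouvillian_extension d C E \<longleftrightarrow>
     (\<exists>(n::nat) (t :: nat \<Rightarrow> 'f) (k :: nat \<Rightarrow> 'f set).
        E = adjoin C (t ` {1..n}) \<and> k 0 = C \<and> k n = E \<and>
        (\<forall>i\<le>n. is_differential_subfield d (k i)) \<and>
        (\<forall>i\<in>{1..n}. k i = adjoin (k (i - 1)) {t i} \<and>
           (d (t i) \<in> k (i - 1) \<or>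
            t i \<noteq> 0 \<and> d (t i) / t i \<in> k (i - 1) \<or>
            algebraic_over (k (i - 1)) (t i))))"

text \<open>
  The liouvillian extension is sought inside the ambient field \<open>'f\<close>. As \<open>'f\<close> is a type
  variable, a statement that no element of any \<open>'f\<close> is liouvillian also covers an element
  of one field that lies in a liouvillian extension sitting in some other field: take the
  latter as \<open>'f\<close>.
\<close>

definition liouvillian_over :: "('f::field \<Rightarrow> 'f) \<Rightarrow> 'f set \<Rightarrow> 'f \<Rightarrow> bool" where
  "liouvillian_over d C y \<longleftrightarrow> (\<exists>E. liouvillian_extension d C E \<and> y \<in> E)"

end

theory Submission
  imports "HOL-Algebra.Algebraic_Closure_Type" Defs
begin

text \<open>
  Why the theorem holds. Let \<open>C = k\<^sub>0 \<subseteq> \<dots> \<subseteq> k\<^sub>n\<close> be a Liouvillian tower and let \<open>P\<close> have the distinct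
  roots \<open>c\<^sub>1, \<dots>, c\<^sub>d\<close> in \<open>C\<close>, with \<open>d \<ge> 3\<close>. A non-constant solution that is algebraic over \<open>k\<^sub>i\<close>
  produces one that is algebraic over the previous field (\<open>solution_descends_one_step\<close>). After \<open>n\<close>
  such steps there is a non-constant solution that is algebraic over \<open>C\<close>; but \<open>C\<close> is algebraically
  closed, so this solution lies in \<open>C\<close> and its derivative vanishes.

  Consider one step \<open>k \<subseteq> k(t)\<close> and a solution \<open>y\<close> that is algebraic over \<open>k(t)\<close>. If \<open>t\<close> is algebraic
  over \<open>k\<close>, so is \<open>y\<close>. Otherwise \<open>t' = t h(t)\<close> for a polynomial \<open>h\<close> over \<open>k\<close>: this is clear for
  an exponential, and a primitive \<open>t\<close> is replaced by \<open>1 / t\<close>, whose derivative is \<open>- t' (1 / t)\<^sup>2\<close>. So the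
  place \<open>t = 0\<close> is stable under the derivation, and \<open>y\<close> is expanded there into a Puiseux series \<open>z\<close> in
  \<open>s = t\<^bsup>1/m\<^esup>\<close>. On series the derivation differentiates the coefficients and adds
  \<open>(s h(s\<^bsup>m\<^esup>) / m) d/ds\<close>; in particular it never lowers the order \<open>v\<close>. Since each \<open>c\<^sub>i\<close> is constant,
  \<open>v(z') \<ge> v(z - c\<^sub>i)\<close> for all \<open>i\<close>, whereas the equation gives \<open>2 v(z') = v(z - c\<^sub>1) + \<dots> + v(z - c\<^sub>d)\<close>.
  If some \<open>v(z - c\<^sub>i)\<close> is negative, then all of them have the same value \<open>r < 0\<close> and \<open>2 r \<le> d r\<close>, which
  contradicts \<open>d \<ge> 3\<close>. If some \<open>v(z - c\<^sub>i) = r\<close> is positive, then the others are zero, because the roots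
  are distinct, and \<open>2 r \<le> r\<close>. Hence all of them are zero: \<open>z\<close> has no pole, and its constant term \<open>a\<close>
  is not a root of \<open>P\<close> and satisfies \<open>a'\<^sup>2 = P(a) \<noteq> 0\<close> (\<open>residue_of_local_solution\<close>). It is algebraic
  over \<open>k\<close>, as one sees by putting \<open>t = 0\<close> in a polynomial relation between \<open>t\<close> and \<open>y\<close> that is not divisible
  by \<open>t\<close>
  (\<open>solution_specialises\<close>).

  The point \<open>a\<close> need not lie in the field that contains the tower, so everything takes place in the
  algebraic closure of that field, to which the derivation extends
  (\<open>derivation_extends_to_alg_closure\<close>). The series comes from Puiseux's theorem (\<open>puiseux\<close>), which is
  derived from Hensel's lemma. That \<open>z\<close> solves the same differential equation as \<open>y\<close> holds because
  \<open>(t, y)\<close> and \<open>(s\<^bsup>m\<^esup>, z)\<close> satisfy the same polynomial relations over \<open>k\<close> (\<open>relations_agree\<close>), and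
  the derivative of an algebraic element is determined by such a relation.
\<close>


section \<open>Ring homomorphisms and derivations along them\<close>

text \<open>
  Relations between several elements are polynomials with polynomial coefficients; they are evaluated
  by applying a homomorphism to the coefficients with \<open>map_poly\<close>.
\<close>

locale idom_hom =
  fixes h :: "'r::idom \<Rightarrow> 's::idom"
  assumes hom_one: "h 1 = 1"
    and hom_add: "h (x + y) = h x + h y"
    and hom_mult: "h (x * y) = h x * h y"
begin

lemma hom_zero: "h 0 = 0"
  using hom_add[of 0 0] by (metis add_0 add_cancel_right_right)

lemma hom_uminus: "h (- x) = - h x"
  using hom_add[of x "- x"] by (simp add: hom_zero eq_neg_iff_add_eq_0 add.commute)

lemma hom_diff: "h (x - y) = h x - h y"
  using hom_add[of x "- y"] by (simp add: hom_uminus)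

lemma hom_power: "h (x ^ n) = h x ^ n"
  by (induction n) (simp_all add: hom_one hom_mult)

lemma hom_of_nat: "h (of_nat n) = of_nat n"
  by (induction n) (simp_all add: hom_zero hom_one hom_add)

lemma hom_prod: "h (prod f A) = (\<Prod>a\<in>A. h (f a))"
  by (induction A rule: infinite_finite_induct) (simp_all add: hom_one hom_mult)

lemmas homs = hom_zero hom_one hom_add hom_mult hom_uminus hom_diff hom_power hom_of_nat

lemma coeff_map: "coeff (map_poly h p) i = h (coeff p i)"
  by (simp add: coeff_map_poly hom_zero)

lemma map_pCons: "map_poly h (pCons a p) = pCons (h a) (map_poly h p)"
  by (rule map_poly_pCons) (rule hom_zero)

lemma map_add: "map_poly h (p + q) = map_poly h p + map_poly h q"
  by (rule poly_eqI) (simp add: coeff_map hom_add)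

lemma map_diff: "map_poly h (p - q) = map_poly h p - map_poly h q"
  by (rule poly_eqI) (simp add: coeff_map hom_diff)

lemma map_smult: "map_poly h (smult c p) = smult (h c) (map_poly h p)"
  by (rule poly_eqI) (simp add: coeff_map hom_mult)

lemma map_mult: "map_poly h (p * q) = map_poly h p * map_poly h q"
  by (induction p) (simp_all add: map_pCons map_add map_smult hom_zero mult_pCons_left)

lemma map_power: "map_poly h (p ^ n) = map_poly h p ^ n"
  by (induction n) (simp_all add: map_mult hom_one)

lemma map_pderiv: "map_poly h (pderiv p) = pderiv (map_poly h p)"
  by (rule poly_eqI) (simp add: coeff_map coeff_pderiv homs del: of_nat_Suc)

lemma poly_map: "poly (map_poly h p) (h x) = h (poly p x)"
  by (induction p) (simp_all add: map_pCons homs)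

lemma eval_hom: "idom_hom (\<lambda>p. poly (map_poly h p) x)"
  by standard (simp_all add: map_add map_mult map_poly_1 hom_one)

lemma map_pcompose: "map_poly h (pcompose p q) = pcompose (map_poly h p) (map_poly h q)"
  by (induction p) (simp_all add: pcompose_pCons map_pCons map_add map_mult homs)

end

lemma idom_hom_id: "idom_hom (\<lambda>x. x)"
  by standard simp_all

lemma idom_hom_comp:
  assumes "idom_hom f" "idom_hom g"
  shows "idom_hom (\<lambda>x. f (g x))"
  using assms by (simp add: idom_hom_def)

text \<open>
  Evaluation at a point turns a derivation of a polynomial ring into an additive map that obeys the
  Leibniz rule only up to that evaluation, which is why the homomorphism \<open>h\<close> is part of the notion.
\<close>

locale derivation_along = idom_hom h for h :: "'r::idom \<Rightarrow> 's::idom" +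
  fixes \<delta> :: "'r \<Rightarrow> 's"
  assumes der_add: "\<delta> (x + y) = \<delta> x + \<delta> y"
    and der_mult: "\<delta> (x * y) = \<delta> x * h y + h x * \<delta> y"
begin

lemma der_zero: "\<delta> 0 = 0"
  using der_add[of 0 0] by (metis add_0 add_cancel_right_right)

lemma der_one: "\<delta> 1 = 0"
  using der_mult[of 1 1] by (metis hom_one mult_1 mult.right_neutral add_cancel_right_right)

lemma der_uminus: "\<delta> (- x) = - \<delta> x"
  using der_add[of x "- x"] by (simp add: der_zero eq_neg_iff_add_eq_0 add.commute)

lemma map_der_pCons: "map_poly \<delta> (pCons a p) = pCons (\<delta> a) (map_poly \<delta> p)"
  by (rule map_poly_pCons) (rule der_zero)

lemma map_der_add: "map_poly \<delta> (p + q) = map_poly \<delta> p + map_poly \<delta> q"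
  by (rule poly_eqI) (simp add: coeff_map_poly der_zero der_add)

lemma map_der_smult:
  "map_poly \<delta> (smult a q) = smult (\<delta> a) (map_poly h q) + smult (h a) (map_poly \<delta> q)"
  by (rule poly_eqI) (simp add: coeff_map_poly der_zero hom_zero der_mult)

lemma map_der_mult:
  "map_poly \<delta> (p * q) = map_poly \<delta> p * map_poly h q + map_poly h p * map_poly \<delta> q"
proof (induction p)
  case (pCons a p)
  thus ?case
    by (simp add: map_der_add map_der_smult map_der_pCons map_pCons der_zero algebra_simps)
qed simp

lemma chain_rule:
  "\<delta> (poly p x) = poly (map_poly \<delta> p) (h x) + poly (pderiv (map_poly h p)) (h x) * \<delta> x"
proof (induction p)
  case (pCons a p)
  thus ?case
    by (simp add: der_add der_mult map_der_pCons map_pCons pderiv_pCons poly_map[symmetric] algebra_simps)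
qed (simp add: der_zero)

text \<open>
  A derivation along \<open>h\<close> extends to polynomials, evaluated at a point \<open>x\<close>, once the derivative
  \<open>c\<close> of the indeterminate has been chosen.
\<close>

lemma extend_to_poly:
  "derivation_along (\<lambda>p. poly (map_poly h p) x)
     (\<lambda>p. poly (map_poly \<delta> p) x + poly (pderiv (map_poly h p)) x * c)"
proof -
  interpret E: idom_hom "\<lambda>p. poly (map_poly h p) x" by (rule eval_hom)
  show ?thesis
    by standard (simp_all add: map_der_add map_add pderiv_add map_der_mult map_mult pderiv_mult
        algebra_simps)
qed

end

lemma derivation_along_comp:
  assumes "derivation_along h \<delta>" "idom_hom f"
  shows "derivation_along (\<lambda>x. f (h x)) (\<lambda>x. f (\<delta> x))"
  using assms by (simp add: derivation_along_def derivation_along_axioms_def idom_hom_def)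

lemma differential_field_derivation:
  "differential_field d \<longleftrightarrow> derivation_along (\<lambda>x. x) d"
  by (simp add: differential_field_def derivation_along_def derivation_along_axioms_def idom_hom_id
      mult.commute)

section \<open>Pseudo-division with coefficients in a subring\<close>

text \<open>
  The fields \<open>k\<^sub>i\<close> of the tower vary with \<open>i\<close>, so they are sets rather than types, and a polynomial
  over \<open>k\<^sub>i\<close> is one whose coefficients lie in that set.
\<close>

definition subring_set :: "'r::comm_ring_1 set \<Rightarrow> bool" where
  "subring_set R \<longleftrightarrow> 0 \<in> R \<and> 1 \<in> R \<and> (\<forall>x\<in>R. \<forall>y\<in>R. x + y \<in> R \<and> x - y \<in> R \<and> x * y \<in> R)"

definition poly_over :: "'r::zero set \<Rightarrow> 'r poly \<Rightarrow> bool" where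
  "poly_over R p \<longleftrightarrow> (\<forall>i. coeff p i \<in> R)"

lemma subring_set_UNIV: "subring_set UNIV"
  by (simp add: subring_set_def)

lemma subring_set_closed:
  assumes "subring_set R"
  shows "0 \<in> R" "1 \<in> R" "x \<in> R \<Longrightarrow> y \<in> R \<Longrightarrow> x + y \<in> R" "x \<in> R \<Longrightarrow> y \<in> R \<Longrightarrow> x - y \<in> R"
    "x \<in> R \<Longrightarrow> y \<in> R \<Longrightarrow> x * y \<in> R" "x \<in> R \<Longrightarrow> - x \<in> R"
proof -
  show neg: "x \<in> R \<Longrightarrow> - x \<in> R"
    using assms unfolding subring_set_def by (metis diff_0)
qed (use assms in \<open>auto simp: subring_set_def\<close>)

lemma subring_set_sum:
  assumes "subring_set R" "\<And>i. i \<in> A \<Longrightarrow> f i \<in> R"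
  shows "sum f A \<in> R"
  using assms(2) by (induction A rule: infinite_finite_induct) (auto simp: subring_set_closed[OF assms(1)])

lemma subring_set_power:
  assumes "subring_set R" "x \<in> R"
  shows "x ^ n \<in> R"
  by (induction n) (simp_all add: subring_set_closed[OF assms(1)] assms(2))

lemma subring_set_of_nat:
  assumes "subring_set R"
  shows "of_nat n \<in> R"
  by (induction n) (simp_all add: subring_set_closed[OF assms])

lemma subring_set_poly_over:
  assumes "subring_set R"
  shows "subring_set {p. poly_over R p}"
  unfolding subring_set_def poly_over_def
  by (auto simp: coeff_mult one_pCons coeff_pCons subring_set_closed[OF assms]
      intro!: subring_set_sum[OF assms] split: nat.splits)

lemmas poly_over_closed = subring_set_closed[OF subring_set_poly_over, simplified]

lemma poly_over_pCons: "poly_over R (pCons a p) \<longleftrightarrow> a \<in> R \<and> poly_over R p"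
  by (auto simp: poly_over_def coeff_pCons split: nat.splits)

lemma poly_over_smult: "subring_set R \<Longrightarrow> c \<in> R \<Longrightarrow> poly_over R p \<Longrightarrow> poly_over R (smult c p)"
  by (simp add: poly_over_def subring_set_closed)

lemma poly_over_monom: "subring_set R \<Longrightarrow> c \<in> R \<Longrightarrow> poly_over R (monom c n)"
  by (simp add: poly_over_def subring_set_closed)

lemma poly_over_map: "f 0 = 0 \<Longrightarrow> (\<And>x. x \<in> R \<Longrightarrow> f x \<in> S) \<Longrightarrow> poly_over R p \<Longrightarrow> poly_over S (map_poly f p)"
  by (simp add: poly_over_def coeff_map_poly)

lemma poly_over_pderiv: "subring_set R \<Longrightarrow> poly_over R p \<Longrightarrow> poly_over R (pderiv p)"
  by (simp add: poly_over_def coeff_pderiv subring_set_closed subring_set_of_nat del: of_nat_Suc)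

lemma poly_over_power: "subring_set R \<Longrightarrow> poly_over R p \<Longrightarrow> poly_over R (p ^ n)"
  using subring_set_power[OF subring_set_poly_over] by simp

text \<open>
  Division with remainder becomes available in every subring after multiplying by a power of the
  leading coefficient; it yields divisibility statements for relations of minimal degree over
  \<open>k[t]\<close> without passing to its field of fractions.
\<close>

lemma pseudo_division:
  fixes p q :: "'r::idom poly"
  assumes R: "subring_set R" and p: "poly_over R p" "p \<noteq> 0" and q: "poly_over R q"
  obtains j g r where "poly_over R g" "poly_over R r" "smult (lead_coeff p ^ j) q = p * g + r"
    "r = 0 \<or> degree r < degree p"
proof -
  have "\<exists>j g r. poly_over R g \<and> poly_over R r \<and> smult (lead_coeff p ^ j) q = p * g + r \<and>
          (r = 0 \<or> degree r < degree p)"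
    using q
  proof (induction "degree q" arbitrary: q rule: less_induct)
    case less
    show ?case
    proof (cases "q = 0 \<or> degree q < degree p")
      case True
      thus ?thesis using less.prems
        by (intro exI[of _ 0] exI[of _ "0::'r poly"] exI[of _ q]) (auto simp: poly_over_closed[OF R])
    next
      case False
      define s where "s = monom (lead_coeff q) (degree q - degree p)"
      define q' where "q' = smult (lead_coeff p) q - p * s"
      have s: "poly_over R s"
        unfolding s_def using less.prems by (intro poly_over_monom R) (simp add: poly_over_def)
      have q': "poly_over R q'"
        unfolding q'_def using p s less.prems
        by (intro poly_over_closed[OF R] poly_over_smult R) (auto simp: poly_over_def)
      have "coeff q' i = 0" if "i \<ge> degree q" for i
      proof (cases "i = degree q")
        case True
        have "coeff (s * p) (degree q) = lead_coeff q * lead_coeff p"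
          using False by (simp add: s_def coeff_monom_mult)
        hence "coeff (p * s) (degree q) = lead_coeff p * lead_coeff q"
          by (simp only: mult.commute)
        thus ?thesis by (simp add: q'_def True)
      next
        case ne: False
        have "degree (p * s) \<le> degree q"
          using False degree_mult_le[of p s] degree_monom_le[of "lead_coeff q" "degree q - degree p"]
          unfolding s_def by linarith
        thus ?thesis using ne that by (simp add: q'_def coeff_eq_0)
      qed
      hence small: "q' = 0 \<or> degree q' < degree q"
        by (metis leading_coeff_0_iff linorder_not_less)
      have "\<exists>j g r. poly_over R g \<and> poly_over R r \<and> smult (lead_coeff p ^ j) q' = p * g + r \<and>
          (r = 0 \<or> degree r < degree p)"
      proof (cases "q' = 0")
        case True
        thus ?thesis
          by (intro exI[of _ 0] exI[of _ "0::'r poly"]) (auto simp: poly_over_closed[OF R])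
      qed (use small less.hyps[OF _ q'] in blast)
      then obtain j g r where jgr: "poly_over R g" "poly_over R r"
        "smult (lead_coeff p ^ j) q' = p * g + r" "r = 0 \<or> degree r < degree p" by blast
      have "smult (lead_coeff p ^ Suc j) q = p * (g + smult (lead_coeff p ^ j) s) + r"
      proof -
        have "smult (lead_coeff p ^ Suc j) q = smult (lead_coeff p ^ j) (q' + p * s)"
          by (simp add: q'_def mult.commute)
        also have "\<dots> = p * g + r + smult (lead_coeff p ^ j) (p * s)"
          by (simp add: smult_add_right jgr(3))
        finally show ?thesis by (simp add: algebra_simps)
      qed
      moreover have "poly_over R (g + smult (lead_coeff p ^ j) s)"
        using p by (intro poly_over_closed[OF R] poly_over_smult R jgr s subring_set_power)
          (simp add: poly_over_def)
      ultimately show ?thesis using jgr by blast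
    qed
  qed
  thus thesis using that by blast
qed


section \<open>Extending a derivation to the algebraic closure\<close>

lemma of_nat_eq_0_char0:
  assumes "CHAR('a::semiring_1) = 0"
  shows "(of_nat n :: 'a) = 0 \<longleftrightarrow> n = 0"
  using assms by (simp add: of_nat_eq_0_iff_char_dvd)

lemma pderiv_eq_0_char0:
  fixes p :: "'a::idom poly"
  assumes "CHAR('a) = 0" "degree p > 0"
  shows "pderiv p \<noteq> 0"
proof
  assume "pderiv p = 0"
  hence "of_nat (degree p) * lead_coeff p = 0"
    using assms(2) coeff_pderiv[of p "degree p - 1"] by simp
  thus False
    using assms by (auto simp: of_nat_eq_0_char0)
qed

lemma degree_pderiv_less:
  fixes p :: "'a::idom poly"
  assumes "degree p > 0"
  shows "degree (pderiv p) < degree p"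
  by (rule degree_lessI) (simp_all add: assms coeff_pderiv coeff_eq_0)

text \<open>
  A relation \<open>p\<close> of minimal degree for \<open>x\<close> is separable in characteristic zero, and differentiating
  \<open>p(x) = 0\<close> forces the value \<open>c\<close> of the derivative of \<open>x\<close>. Every other relation is, up to a
  nonzero factor, a multiple of \<open>p\<close> plus a polynomial that evaluates to zero coefficientwise, so it is
  compatible with the same \<open>c\<close>.
\<close>

lemma derivation_extends_to_algebraic_element:
  fixes h :: "'r::idom \<Rightarrow> 'a::field"
  assumes der: "derivation_along h \<delta>" and char: "CHAR('a) = 0"
    and ker: "\<And>a. h a = 0 \<Longrightarrow> \<delta> a = 0"
    and alg: "map_poly h p0 \<noteq> 0" "poly (map_poly h p0) x = 0"
  obtains c where
    "\<And>q. poly (map_poly h q) x = 0 \<Longrightarrow>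
       poly (map_poly \<delta> q) x + poly (pderiv (map_poly h q)) x * c = 0"
    "\<And>c'. (\<And>q. poly (map_poly h q) x = 0 \<Longrightarrow>
       poly (map_poly \<delta> q) x + poly (pderiv (map_poly h q)) x * c' = 0) \<Longrightarrow> c' = c"
proof -
  interpret derivation_along h \<delta> by (rule der)
  obtain p where p: "map_poly h p \<noteq> 0" "poly (map_poly h p) x = 0"
    and min: "\<And>q. map_poly h q \<noteq> 0 \<Longrightarrow> poly (map_poly h q) x = 0 \<Longrightarrow> degree p \<le> degree q"
    using alg ex_has_least_nat[of "\<lambda>p. map_poly h p \<noteq> 0 \<and> poly (map_poly h p) x = 0" p0 degree]
    by blast
  have deg0: "degree p > 0"
  proof (rule ccontr)
    assume "\<not> degree p > 0"
    then obtain a where "p = [:a:]" by (auto elim: degree_eq_zeroE)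
    thus False using p by (simp add: map_pCons)
  qed
  have lead: "h (lead_coeff p) \<noteq> 0"
  proof
    assume *: "h (lead_coeff p) = 0"
    define p' where "p' = p - monom (lead_coeff p) (degree p)"
    have "map_poly h p' = map_poly h p"
      using * by (intro poly_eqI) (auto simp: p'_def coeff_map hom_diff hom_zero)
    moreover have "degree p' < degree p"
    proof -
      have "coeff p' i = 0" if "i \<ge> degree p" for i
        using that by (cases "i = degree p") (simp_all add: p'_def coeff_eq_0)
      thus ?thesis using deg0 degree_lessI by blast
    qed
    ultimately show False using min[of p'] p by simp
  qed
  have dmu: "poly (pderiv (map_poly h p)) x \<noteq> 0"
  proof
    assume *: "poly (pderiv (map_poly h p)) x = 0"
    have "degree (map_poly h p) = degree p"
      by (rule map_poly_degree_eq) (rule lead)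
    hence "pderiv (map_poly h p) \<noteq> 0"
      using deg0 by (intro pderiv_eq_0_char0 char) simp
    moreover have "degree (pderiv p) < degree p"
      by (rule degree_pderiv_less) (rule deg0)
    ultimately show False
      using min[of "pderiv p"] * by (simp add: map_pderiv)
  qed
  define c where "c = - poly (map_poly \<delta> p) x / poly (pderiv (map_poly h p)) x"
  define E where "E = (\<lambda>q. poly (map_poly h q) x)"
  define \<Delta> where "\<Delta> = (\<lambda>q. poly (map_poly \<delta> q) x + poly (pderiv (map_poly h q)) x * c)"
  interpret E: derivation_along E \<Delta>
    unfolding E_def \<Delta>_def by (rule extend_to_poly)
  have p0: "E p = 0" "\<Delta> p = 0"
    using p dmu by (simp_all add: E_def \<Delta>_def c_def)
  show thesis
  proof (rule that[of c])
    fix q assume q: "poly (map_poly h q) x = 0"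
    have "p \<noteq> 0" using deg0 by auto
    then obtain j g r where gr: "smult (lead_coeff p ^ j) q = p * g + r"
      "r = 0 \<or> degree r < degree p"
      using pseudo_division[of UNIV p q] subring_set_UNIV by (auto simp: poly_over_def)
    define l where "l = lead_coeff p ^ j"
    have l: "h l \<noteq> 0" using lead by (simp add: l_def hom_power)
    have eq: "[:l:] * q = p * g + r" using gr(1) by (simp add: l_def)
    have "E q = 0" using q by (simp add: E_def)
    hence "E r = 0"
      using arg_cong[OF eq, of E] p0 unfolding E.hom_add E.hom_mult by simp
    hence "map_poly h r = 0"
      using gr(2) min[of r] by (fastforce simp: E_def)
    hence "h (coeff r i) = 0" for i
      by (metis coeff_0 coeff_map)
    hence "map_poly \<delta> r = 0"
      by (intro poly_eqI) (simp add: coeff_map_poly der_zero ker)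
    hence "\<Delta> r = 0" using \<open>map_poly h r = 0\<close> by (simp add: \<Delta>_def)
    hence "E [:l:] * \<Delta> q = 0"
      using arg_cong[OF eq, of \<Delta>] p0 \<open>E q = 0\<close> unfolding E.der_add E.der_mult by simp
    moreover have "E [:l:] = h l" by (simp add: E_def map_pCons)
    ultimately have "\<Delta> q = 0" using l by simp
    thus "poly (map_poly \<delta> q) x + poly (pderiv (map_poly h q)) x * c = 0"
      by (simp add: \<Delta>_def)
  next
    fix c' assume "\<And>q. poly (map_poly h q) x = 0 \<Longrightarrow>
       poly (map_poly \<delta> q) x + poly (pderiv (map_poly h q)) x * c' = 0"
    hence "poly (map_poly \<delta> p) x + poly (pderiv (map_poly h p)) x * c' = 0" using p by blast
    moreover have "poly (map_poly \<delta> p) x + poly (pderiv (map_poly h p)) x * c = 0"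
      using p0(2) by (simp only: \<Delta>_def)
    ultimately have "poly (pderiv (map_poly h p)) x * c' = poly (pderiv (map_poly h p)) x * c"
      by (metis add_left_cancel)
    thus "c' = c" using dmu by simp
  qed
qed

lemma to_ac_hom: "idom_hom to_ac"
  by standard simp_all

text \<open>
  The preceding lemma, used over the base field, singles out one candidate \<open>D x\<close> for each \<open>x\<close>.
  Additivity and the Leibniz rule relate two elements \<open>x\<close>, \<open>y\<close>. To obtain them, the lemma is used
  a second time over the ring of polynomials in \<open>x\<close>: this gives a derivation on polynomials in \<open>x\<close>
  and \<open>y\<close>, and by uniqueness it computes \<open>D\<close> at every element \<open>G(x, y)\<close>, in particular at \<open>x + y\<close>
  and \<open>x y\<close>.
\<close>

theorem derivation_extends_to_alg_closure:
  fixes d :: "'f::field \<Rightarrow> 'f"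
  assumes d: "differential_field d" and char: "CHAR('f) = 0"
  obtains D :: "'f alg_closure \<Rightarrow> 'f alg_closure" where
    "differential_field D" "\<And>a. D (to_ac a) = to_ac (d a)"
proof -
  define e where "e = (to_ac :: 'f \<Rightarrow> 'f alg_closure)"
  define \<delta> where "\<delta> = (\<lambda>a. e (d a))"
  interpret d: derivation_along "\<lambda>x::'f. x" d
    using d by (simp add: differential_field_derivation)
  interpret e: idom_hom e unfolding e_def by (rule to_ac_hom)
  interpret \<delta>: derivation_along e \<delta>
    unfolding \<delta>_def using derivation_along_comp[OF d.derivation_along_axioms e.idom_hom_axioms] .
  have ker: "e a = 0 \<Longrightarrow> \<delta> a = 0" for a
    by (simp add: e_def \<delta>_def d.der_zero)
  have char': "CHAR('f alg_closure) = 0" using char by simp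
  have e_inj: "map_poly e p = 0 \<longleftrightarrow> p = 0" for p
    by (rule map_poly_eq_0_iff) (simp_all add: e_def)
  define is_deriv where "is_deriv = (\<lambda>x c. \<forall>q. poly (map_poly e q) x = 0 \<longrightarrow>
    poly (map_poly \<delta> q) x + poly (pderiv (map_poly e q)) x * c = 0)"
  have ex1: "\<exists>!c. is_deriv x c" for x
  proof -
    obtain p :: "'f poly" where "p \<noteq> 0" "poly (map_poly to_ac p) x = 0"
      by (rule alg_closure_algebraic)
    then obtain c where "is_deriv x c" "\<And>c'. is_deriv x c' \<Longrightarrow> c' = c"
      using derivation_extends_to_algebraic_element[OF \<delta>.derivation_along_axioms char' ker, of p x]
      unfolding is_deriv_def e_inj by (simp add: e_def) metis
    thus ?thesis by blast
  qed
  define D where "D = (\<lambda>x. THE c. is_deriv x c)"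
  have D: "is_deriv x c \<longleftrightarrow> D x = c" for x c
    unfolding D_def using ex1[of x] by (metis theI')
  have D_e: "D (e a) = e (d a)" for a
  proof -
    have "is_deriv (e a) (D (e a))" by (simp add: D)
    hence "poly (map_poly \<delta> [:- a, 1:]) (e a) +
        poly (pderiv (map_poly e [:- a, 1:])) (e a) * D (e a) = 0"
      unfolding is_deriv_def by (elim allE[of _ "[:-a, 1:]"] mp) (simp add: e.map_pCons e.homs)
    thus ?thesis
      by (simp add: \<delta>.map_der_pCons \<delta>.der_one \<delta>.der_uminus e.map_pCons e.homs pderiv_pCons)
        (simp add: \<delta>_def)
  qed
  have D_ring: "D (x + y) = D x + D y" "D (x * y) = D x * y + x * D y" for x y
  proof -
    define E where "E = (\<lambda>q. poly (map_poly e q) x)"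
    define \<Delta> where "\<Delta> = (\<lambda>q. poly (map_poly \<delta> q) x + poly (pderiv (map_poly e q)) x * D x)"
    interpret E: derivation_along E \<Delta>
      unfolding E_def \<Delta>_def by (rule \<delta>.extend_to_poly)
    have kerE: "E q = 0 \<Longrightarrow> \<Delta> q = 0" for q
      using D[of x "D x"] by (simp add: is_deriv_def E_def \<Delta>_def)
    have E_const: "E [:a:] = e a" for a by (simp add: E_def e.map_pCons)
    have \<Delta>_const: "\<Delta> [:a:] = \<delta> a" for a
      by (simp add: \<Delta>_def e.map_pCons \<delta>.map_der_pCons pderiv_pCons)
    define lift where "lift = map_poly (\<lambda>a::'f. [:a:])"
    interpret const: idom_hom "\<lambda>a::'f. [:a:]" by standard (simp_all add: one_pCons)
    have E_lift: "map_poly E (lift q) = map_poly e q" "map_poly \<Delta> (lift q) = map_poly \<delta> q" for q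
      by (rule poly_eqI; simp add: lift_def coeff_map_poly E.hom_zero E.der_zero const.hom_zero E_const
          \<Delta>_const e.hom_zero \<delta>.der_zero)+
    obtain q where q: "q \<noteq> 0" "poly (map_poly to_ac q) y = 0"
      by (rule alg_closure_algebraic)
    obtain c where c: "\<And>q. poly (map_poly E q) y = 0 \<Longrightarrow>
       poly (map_poly \<Delta> q) y + poly (pderiv (map_poly E q)) y * c = 0"
    proof (rule derivation_extends_to_algebraic_element[OF E.derivation_along_axioms char' kerE])
      show "map_poly E (lift q) \<noteq> 0" "poly (map_poly E (lift q)) y = 0"
        using q by (simp_all add: E_lift e_inj) (simp add: e_def)
    next
      fix c assume "\<And>q. poly (map_poly E q) y = 0 \<Longrightarrow>
        poly (map_poly \<Delta> q) y + poly (pderiv (map_poly E q)) y * c = 0"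
      thus thesis by (rule that)
    qed
    \<comment> \<open>constant polynomials in \<open>x\<close> show that \<open>c\<close> is also the derivative of \<open>y\<close> over the base field\<close>
    have "is_deriv y c"
      unfolding is_deriv_def using c[of "lift _"] by (simp add: E_lift)
    hence c_eq: "c = D y" by (simp add: D)
    define E2 where "E2 = (\<lambda>q. poly (map_poly E q) y)"
    define \<Delta>2 where "\<Delta>2 = (\<lambda>q. poly (map_poly \<Delta> q) y + poly (pderiv (map_poly E q)) y * D y)"
    interpret E2: derivation_along E2 \<Delta>2
      unfolding E2_def \<Delta>2_def by (rule E.extend_to_poly)
    have kerE2: "E2 q = 0 \<Longrightarrow> \<Delta>2 q = 0" for q
      using c by (simp add: c_eq E2_def \<Delta>2_def)
    have E2_const: "E2 [:[:a:]:] = e a" for a by (simp add: E2_def E.map_pCons E_const)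
    have \<Delta>2_const: "\<Delta>2 [:[:a:]:] = \<delta> a" for a
      by (simp add: \<Delta>2_def E.map_pCons E.map_der_pCons \<Delta>_const pderiv_pCons)
    define lift2 where "lift2 = map_poly (\<lambda>a::'f. [:[:a:]:])"
    interpret const2: idom_hom "\<lambda>a::'f. [:[:a:]:]" by standard (simp_all add: one_pCons)
    have E2_lift: "map_poly E2 (lift2 q) = map_poly e q" "map_poly \<Delta>2 (lift2 q) = map_poly \<delta> q" for q
      by (rule poly_eqI; simp add: lift2_def coeff_map_poly E2.hom_zero E2.der_zero const2.hom_zero
          E2_const \<Delta>2_const e.hom_zero \<delta>.der_zero)+
    have D_E2: "D (E2 G) = \<Delta>2 G" for G
    proof -
      have "is_deriv (E2 G) (\<Delta>2 G)"
        unfolding is_deriv_def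
      proof (intro allI impI)
        fix q assume "poly (map_poly e q) (E2 G) = 0"
        hence "E2 (poly (lift2 q) G) = 0"
          using E2.poly_map[of "lift2 q" G] by (simp add: E2_lift)
        hence "\<Delta>2 (poly (lift2 q) G) = 0" by (rule kerE2)
        thus "poly (map_poly \<delta> q) (E2 G) + poly (pderiv (map_poly e q)) (E2 G) * \<Delta>2 G = 0"
          by (simp add: E2.chain_rule E2_lift)
      qed
      thus ?thesis by (simp add: D)
    qed
    define U :: "'f poly poly" where "U = [:[:0, 1:]:]"
    define V :: "'f poly poly" where "V = [:0, 1:]"
    have EU: "E2 U = x" and EV: "E2 V = y"
      by (simp_all add: E2_def U_def V_def E.map_pCons E.homs) (simp_all add: E_def e.map_pCons e.homs)
    show "D (x + y) = D x + D y" "D (x * y) = D x * y + x * D y"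
      using D_E2[of U] D_E2[of V] D_E2[of "U + V"] D_E2[of "U * V"]
      by (simp_all add: E2.homs E2.der_add E2.der_mult EU EV)
  qed
  have "differential_field D" by unfold_locales (rule D_ring)+
  thus thesis using that D_e by (simp add: e_def)
qed


section \<open>Hensel factorisation over formal power series\<close>

lemma bezout_division_step:
  fixes g h u v R :: "'a::field poly"
  assumes "g * u + h * v = 1"
  shows "g * (u * R + h * ((v * R) div g)) + ((v * R) mod g) * h = R"
proof -
  define d m where "d = (v * R) div g" and "m = (v * R) mod g"
  have "v * R = d * g + m" by (simp add: d_def m_def)
  hence "g * (u * R + h * d) + m * h = (g * u + h * v) * R"
    by (simp only: distrib_right mult.assoc) (simp add: algebra_simps)
  thus ?thesis by (simp add: assms d_def m_def)
qed

text \<open>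
  Hensel's lemma lifts a coprime factorisation \<open>g h\<close> of the constant term of \<open>\<Sum>\<^sub>j Q\<^sub>j X\<^sup>j\<close>. The
  coefficients \<open>g\<^sub>j\<close>, \<open>h\<^sub>j\<close> of the lifted factors must satisfy \<open>g h\<^sub>j + h g\<^sub>j = R\<close>, where \<open>R\<close> is what
  the earlier coefficients leave of \<open>Q\<^sub>j\<close>. The Bezout relation \<open>g u + h v = 1\<close> solves this equation,
  and reducing \<open>v R\<close> modulo \<open>g\<close> keeps the degrees bounded.
\<close>

context
  fixes g h u v :: "'a::field poly" and Q :: "nat \<Rightarrow> 'a poly"
begin

function hensel_factors :: "nat \<Rightarrow> 'a poly \<times> 'a poly" where
  "hensel_factors j = (if j = 0 then (g, h) else
     let R = Q j - (\<Sum>i\<in>{1..<j}. fst (hensel_factors i) * snd (hensel_factors (j - i)))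
     in ((v * R) mod g, u * R + h * ((v * R) div g)))"
  by auto
termination by (relation "Wellfounded.measure id") auto

declare hensel_factors.simps [simp del]

lemma hensel_factors_0: "hensel_factors 0 = (g, h)"
  by (simp add: hensel_factors.simps)

lemma hensel_factors_convolution:
  assumes "g * h = Q 0" "g * u + h * v = 1"
  shows "(\<Sum>i\<le>j. fst (hensel_factors i) * snd (hensel_factors (j - i))) = Q j"
proof (cases "j = 0")
  case False
  define f where "f = (\<lambda>i. fst (hensel_factors i) * snd (hensel_factors (j - i)))"
  define R where "R = Q j - (\<Sum>i\<in>{1..<j}. f i)"
  have step: "hensel_factors j = ((v * R) mod g, u * R + h * ((v * R) div g))"
    using False by (subst hensel_factors.simps) (simp add: R_def f_def Let_def)
  have "{..j} = insert 0 (insert j {1..<j})" using False by auto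
  hence "(\<Sum>i\<le>j. f i) = f 0 + (f j + (\<Sum>i\<in>{1..<j}. f i))"
    using False by simp
  also have "\<dots> = R + (\<Sum>i\<in>{1..<j}. f i)"
    using bezout_division_step[OF assms(2), of R] by (simp add: f_def hensel_factors_0 step add.assoc[symmetric])
  finally show ?thesis
    by (simp add: R_def f_def)
qed (simp add: hensel_factors_0 assms(1))

lemma coeff_mult_vanishes:
  fixes a b :: "'a poly"
  assumes "\<And>i. i \<ge> m \<Longrightarrow> coeff a i = 0" "\<And>i. i \<ge> n \<Longrightarrow> coeff b i = 0" "i \<ge> m + n"
  shows "coeff (a * b) i = 0"
  unfolding coeff_mult
proof (rule sum.neutral, rule ballI)
  fix k
  have "k \<ge> m \<or> i - k \<ge> n" using assms(3) by linarith
  thus "coeff a k * coeff b (i - k) = 0" using assms(1,2) by auto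
qed

lemma hensel_factors_degree:
  assumes "g * h = Q 0" "g * u + h * v = 1" "g \<noteq> 0" "h \<noteq> 0"
    and Q: "\<And>j i. j > 0 \<Longrightarrow> i \<ge> degree g + degree h \<Longrightarrow> coeff (Q j) i = 0"
  shows "j > 0 \<Longrightarrow> (\<forall>i\<ge>degree g. coeff (fst (hensel_factors j)) i = 0) \<and>
           (\<forall>i\<ge>degree h. coeff (snd (hensel_factors j)) i = 0)"
proof (induction j rule: less_induct)
  case (less j)
  define f where "f = (\<lambda>i. fst (hensel_factors i) * snd (hensel_factors (j - i)))"
  define R where "R = Q j - (\<Sum>i\<in>{1..<j}. f i)"
  define a where "a = (v * R) mod g"
  define b where "b = u * R + h * ((v * R) div g)"
  have step: "hensel_factors j = (a, b)"
    using less.prems by (subst hensel_factors.simps) (simp add: R_def f_def Let_def a_def b_def)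
  have "coeff (f k) i = 0" if "k \<in> {1..<j}" "i \<ge> degree g + degree h" for k i
    unfolding f_def using that less.IH[of k] less.IH[of "j - k"]
    by (intro coeff_mult_vanishes[of "degree g" _ "degree h"]) auto
  hence R: "coeff R i = 0" if "i \<ge> degree g + degree h" for i
    using that Q[of j i] less.prems by (simp add: R_def coeff_sum)
  have a: "coeff a i = 0" if "i \<ge> degree g" for i
  proof -
    have "a = 0 \<or> degree a < degree g"
      unfolding a_def by (rule degree_mod_less) (rule assms(3))
    thus ?thesis using that by (auto intro: coeff_eq_0)
  qed
  have "g * b + a * h = R"
    unfolding a_def b_def by (rule bezout_division_step) (rule assms(2))
  hence "g * b = R - h * a" by (simp add: eq_diff_eq mult.commute)
  moreover have "coeff (h * a) i = 0" if "i \<ge> degree g + degree h" for i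
  proof (cases "a = 0 \<or> degree a < degree g")
    case True
    hence "a = 0 \<or> degree (h * a) < i"
      using that degree_mult_le[of h a] by auto
    thus ?thesis by (auto intro: coeff_eq_0)
  qed (use a[of "degree a"] in \<open>auto simp: not_less\<close>)
  ultimately have gb: "coeff (g * b) i = 0" if "i \<ge> degree g + degree h" for i
    using that R by simp
  have b: "coeff b i = 0" if "i \<ge> degree h" for i
  proof (cases "b = 0")
    case False
    have "degree b < degree h"
    proof (rule ccontr)
      assume "\<not> degree b < degree h"
      hence "coeff (g * b) (degree g + degree b) = 0" by (intro gb) simp
      thus False using assms(3) False by (simp add: coeff_mult_degree_sum)
    qed
    thus ?thesis using that by (intro coeff_eq_0) simp
  qed simp
  show ?case using a b by (simp add: step)
qed

end

text \<open>
  The recursion produces a power series with polynomial coefficients. Its degree bounds make it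
  possible to read it as a polynomial with power series coefficients (the function \<open>collect\<close>).
\<close>

theorem hensel_factorisation:
  fixes q :: "'a::field fps poly"
  assumes q: "lead_coeff q = 1" and gh: "g * h = map_poly (\<lambda>f. fps_nth f 0) q"
    and monic: "lead_coeff g = 1" "lead_coeff h = 1" and bezout: "g * u + h * v = 1"
  obtains G H where "q = G * H" "degree G = degree g"
proof -
  define Q where "Q = (\<lambda>j. map_poly (\<lambda>f. fps_nth f j) q)"
  have coeff_Q: "coeff (Q j) i = fps_nth (coeff q i) j" for j i
    by (simp add: Q_def coeff_map_poly)
  have nz: "g \<noteq> 0" "h \<noteq> 0" using monic by auto
  have gh': "g * h = Q 0" by (simp add: gh Q_def)
  have "degree (Q 0) = degree q"
    unfolding Q_def by (rule map_poly_degree_eq) (simp add: q)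
  hence deg: "degree q = degree g + degree h"
    using nz by (simp add: gh'[symmetric] degree_mult_eq)
  have high: "coeff (Q j) i = 0" if "j > 0" "i \<ge> degree g + degree h" for i j
    using that q by (cases "i = degree q") (auto simp: coeff_Q deg coeff_eq_0)
  define F where "F = hensel_factors g h u v Q"
  note F_deg = hensel_factors_degree[where Q = Q, OF gh' bezout nz high, folded F_def]
  have F0: "F 0 = (g, h)" by (simp add: F_def hensel_factors_0)
  define collect :: "nat \<Rightarrow> (nat \<Rightarrow> 'a poly) \<Rightarrow> 'a fps poly" where
    "collect n A = Poly (map (\<lambda>i. Abs_fps (\<lambda>j. coeff (A j) i)) [0..<Suc n])" for n A
  have coeff_collect: "fps_nth (coeff (collect n A) i) j = coeff (A j) i"
    if "\<And>j i. i > n \<Longrightarrow> coeff (A j) i = 0" for n A i j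
    using that by (auto simp: collect_def nth_default_def simp del: upt_Suc)
  define G where "G = collect (degree g) (\<lambda>j. fst (F j))"
  define H where "H = collect (degree h) (\<lambda>j. snd (F j))"
  have coeff_G: "fps_nth (coeff G i) j = coeff (fst (F j)) i" for i j
    unfolding G_def using F_deg F0 by (intro coeff_collect) (metis coeff_eq_0 fst_conv gr0I less_imp_le)
  have coeff_H: "fps_nth (coeff H i) j = coeff (snd (F j)) i" for i j
    unfolding H_def using F_deg F0 by (intro coeff_collect) (metis coeff_eq_0 snd_conv gr0I less_imp_le)
  have "q = G * H"
  proof (intro poly_eqI fps_ext)
    fix i j
    have "fps_nth (coeff (G * H) i) j =
        (\<Sum>a\<le>i. \<Sum>b\<le>j. coeff (fst (F b)) a * coeff (snd (F (j - b))) (i - a))"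
      by (simp add: coeff_mult fps_sum_nth fps_mult_nth coeff_G coeff_H atLeast0AtMost)
    also have "\<dots> = coeff (\<Sum>b\<le>j. fst (F b) * snd (F (j - b))) i"
      by (subst sum.swap) (simp add: coeff_sum coeff_mult)
    also have "\<dots> = fps_nth (coeff q i) j"
      unfolding F_def by (simp add: hensel_factors_convolution[of g h Q u v, OF gh' bezout] coeff_Q)
    finally show "fps_nth (coeff q i) j = fps_nth (coeff (G * H) i) j" by simp
  qed
  moreover have "degree G = degree g"
  proof (rule antisym)
    show "degree G \<le> degree g"
    proof (intro degree_le allI impI)
      fix i assume "degree g < i"
      hence "coeff (fst (F j)) i = 0" for j
        using F_deg F0 by (metis coeff_eq_0 fst_conv gr0I less_imp_le)
      thus "coeff G i = 0" by (intro fps_ext) (simp add: coeff_G)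
    qed
    have "fps_nth (coeff G (degree g)) 0 \<noteq> 0" using monic by (simp add: coeff_G F0)
    thus "degree g \<le> degree G" by (metis fps_zero_nth le_degree)
  qed
  ultimately show thesis by (rule that)
qed

section \<open>Puiseux's theorem\<close>

text \<open>
  This is what allows the second-highest coefficient to be translated away; it also determines that
  coefficient for a power of a linear polynomial.
\<close>

lemma coeff_pcompose_shift_below_lead:
  fixes p :: "'a::comm_ring_1 poly"
  shows "degree p \<le> n \<Longrightarrow> coeff (pcompose p [:b, 1:]) n = coeff p n"
    and "degree p \<le> Suc n \<Longrightarrow>
      coeff (pcompose p [:b, 1:]) n = coeff p n + of_nat (Suc n) * b * coeff p (Suc n)"
proof (induction p arbitrary: n)
  case (pCons a p)
  have deg: "degree p \<le> n" if "degree (pCons a p) \<le> Suc n" for n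
    using that by (cases "p = 0") simp_all
  { case 1
    have high: "coeff (pcompose p [:b, 1:]) (Suc k) = 0" if "degree p \<le> k" for k
      using pCons.IH(1)[of "Suc k"] that by (simp add: coeff_eq_0)
    show ?case
    proof (cases n)
      case 0
      hence "p = 0" using 1 by (metis degree_pCons_eq le_zero_eq nat.distinct(1))
      thus ?thesis using 0 by simp
    next
      case (Suc k)
      thus ?thesis using 1 deg[of k] high[of k] pCons.IH(1)[of k]
        by (simp add: pcompose_pCons coeff_pCons)
    qed
  next
    case 2
    show ?case
    proof (cases n)
      case 0
      thus ?thesis using 2 deg[of 0] pCons.IH(1)[of 0] by (simp add: pcompose_pCons)
    next
      case (Suc k)
      thus ?thesis using 2 deg[of n] pCons.IH(1)[of "Suc k"] pCons.IH(2)[of k]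
        by (simp add: pcompose_pCons coeff_pCons algebra_simps)
    qed
  }
qed simp_all

lemma fls_compose_power_hom:
  "m > 0 \<Longrightarrow> idom_hom (\<lambda>f :: 'a::idom fls. fls_compose_power f m)"
  by standard simp_all

lemma fls_compose_power_twice:
  assumes "a > 0" "b > 0"
  shows "fls_compose_power (fls_compose_power f a) b = fls_compose_power f (a * b)"
proof (rule fls_eqI)
  fix n
  have "int (a * b) dvd n \<longleftrightarrow> int b dvd n \<and> int a dvd n div int b"
    using assms by (auto simp: dvd_def)
  thus "fls_nth (fls_compose_power (fls_compose_power f a) b) n = fls_nth (fls_compose_power f (a * b)) n"
    using assms by (simp add: fls_nth_compose_power zdiv_zmult2_eq[symmetric] mult.commute)
qed

lemma fls_subdegree_compose_power:
  fixes f :: "'a::idom fls"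
  assumes "m > 0" "f \<noteq> 0"
  shows "fls_subdegree (fls_compose_power f m) = int m * fls_subdegree f"
    "fls_compose_power f m \<noteq> 0"
proof -
  have nz: "fls_nth (fls_compose_power f m) (int m * fls_subdegree f) \<noteq> 0"
    using assms by (simp add: fls_nth_compose_power)
  thus "fls_compose_power f m \<noteq> 0" by auto
  show "fls_subdegree (fls_compose_power f m) = int m * fls_subdegree f"
  proof (rule fls_subdegree_eqI[OF nz])
    fix k assume k: "k < int m * fls_subdegree f"
    show "fls_nth (fls_compose_power f m) k = 0"
    proof (cases "int m dvd k")
      case True
      then obtain l where l: "k = int m * l" by (elim dvdE)
      hence "l < fls_subdegree f" using k assms by simp
      thus ?thesis using assms l by (simp add: fls_nth_compose_power)
    qed (use assms in \<open>simp add: fls_nth_compose_power\<close>)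
  qed
qed

text \<open>
  Modulo \<open>X - c\<close> the polynomial \<open>h\<close> is the nonzero constant \<open>h(c)\<close>, so \<open>e = 1 - h / h(c)\<close> is divisible
  by \<open>X - c\<close>, and the geometric series of \<open>e\<close> inverts \<open>h\<close> modulo \<open>(X - c)\<^sup>m\<close>.
\<close>

lemma bezout_linear_power:
  fixes h :: "'a::field poly"
  assumes "poly h c \<noteq> 0"
  obtains u v where "[:- c, 1:] ^ m * u + h * v = 1"
proof -
  define k where "k = poly h c"
  define e where "e = 1 - smult (1 / k) h"
  have "poly e c = 0" using assms by (simp add: e_def k_def)
  then obtain w where w: "e = [:- c, 1:] * w" by (auto simp: poly_eq_0_iff_dvd)
  have "1 - e ^ m = (1 - e) * (\<Sum>i<m. e ^ i)" by (rule one_diff_power_eq)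
  hence "1 - e ^ m = h * smult (1 / k) (\<Sum>i<m. e ^ i)" by (simp add: e_def)
  hence "[:- c, 1:] ^ m * w ^ m + h * smult (1 / k) (\<Sum>i<m. e ^ i) = 1"
    by (simp add: w power_mult_distrib[symmetric] algebra_simps)
  thus thesis by (rule that)
qed


lemma linear_power_lower_coeff:
  assumes "n > 0"
  shows "coeff ([:b, 1:] ^ n) (n - 1) = of_nat n * (b :: 'a::idom)"
proof -
  have "[:b, 1:] ^ n = pcompose (monom 1 n) [:b, 1:]"
  proof (induction n)
    case (Suc n)
    thus ?case by (simp add: monom_Suc pcompose_pCons)
  qed (simp add: pcompose_1)
  thus ?thesis
    using coeff_pcompose_shift_below_lead(2)[of "monom (1::'a) n" "n - 1" b] assms
    by (simp add: degree_monom_eq)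
qed

lemma CHAR_fls: "CHAR('a::comm_ring_1 fls) = CHAR('a)"
proof (rule CHAR_eqI)
  show "of_nat CHAR('a) = (0 :: 'a fls)" by (simp add: fls_of_nat)
  show "CHAR('a) dvd n" if "of_nat n = (0 :: 'a fls)" for n
    using that by (simp add: fls_of_nat of_nat_eq_0_iff_char_dvd fls_const_nonzero)
qed

lemma poly_eq_sum_le:
  fixes p :: "'a::comm_semiring_1 poly"
  assumes "degree p \<le> n"
  shows "poly p x = (\<Sum>i\<le>n. coeff p i * x ^ i)"
  unfolding poly_altdef using assms
  by (intro sum.mono_neutral_left) (auto simp: coeff_eq_0 not_le)

text \<open>
  Induction on the degree \<open>n\<close>. After a translation the coefficient of \<open>Y\<^bsup>n-1\<^esup>\<close> vanishes. Scaling \<open>Y\<close> by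
  the power of \<open>X\<close> given by the extremal slope of the Newton polygon (which is a rational number, hence
  the passage from \<open>X\<close> to \<open>X\<^sup>m\<close>) makes the coefficients integral and some lower coefficient a unit.
  The reduction then has two distinct roots: it could otherwise only be \<open>(Y - b)\<^sup>n\<close>, where the vanishing
  coefficient forces \<open>b = 0\<close>, contrary to the unit. Hensel's lemma splits off a factor of smaller
  degree.
\<close>

theorem puiseux:
  fixes p :: "'a::alg_closed_field fls poly"
  assumes char: "CHAR('a) = 0" and "degree p > 0"
  shows "\<exists>m>0. \<exists>z. poly (map_poly (\<lambda>f. fls_compose_power f m) p) z = 0"
  using assms(2)
proof (induction "degree p" arbitrary: p rule: less_induct)
  case less
  define n where "n = degree p"
  have n: "n > 0" using less.prems by (simp add: n_def)
  have of_nat_n: "(of_nat n :: 'a) \<noteq> 0" "(of_nat n :: 'a fls) \<noteq> 0"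
    using n char by (simp_all add: of_nat_eq_0_iff_char_dvd CHAR_fls)
  define \<sigma> where "\<sigma> = (\<lambda>m f. fls_compose_power f m :: 'a fls)"
  have \<sigma>_hom: "m > 0 \<Longrightarrow> idom_hom (\<sigma> m)" for m
    unfolding \<sigma>_def by (rule fls_compose_power_hom)
  \<comment> \<open>\<open>p2\<close> is monic, and its coefficient below the leading one is translated away\<close>
  define p1 where "p1 = smult (inverse (lead_coeff p)) p"
  define a where "a = coeff p1 (n - 1) / of_nat n"
  define p2 where "p2 = pcompose p1 [:- a, 1:]"
  have "p \<noteq> 0" using less.prems by auto
  have p_p1: "p = smult (lead_coeff p) p1" using \<open>p \<noteq> 0\<close> by (simp add: p1_def)
  have p1: "degree p1 = n" "coeff p1 n = 1" using \<open>p \<noteq> 0\<close> by (simp_all add: p1_def n_def)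
  have p2: "degree p2 = n" "coeff p2 n = 1"
    using coeff_pcompose_shift_below_lead(1)[of p1 n "- a"] p1
    by (simp_all add: p2_def degree_pcompose)
  have p2_below: "coeff p2 (n - 1) = 0"
    using coeff_pcompose_shift_below_lead(2)[of p1 "n - 1" "- a"] p1 n of_nat_n
    by (simp add: p2_def a_def)
  have p1_p2: "p1 = pcompose p2 [:a, 1:]"
    by (simp add: p2_def pcompose_pCons flip: pcompose_assoc)
  have transfer: "poly (map_poly (\<sigma> m) p) (z - \<sigma> m a) = 0" if "poly (map_poly (\<sigma> m) p2) z = 0" "m > 0" for m z
  proof -
    interpret idom_hom "\<sigma> m" by (rule \<sigma>_hom) (rule that)
    show ?thesis using that p1_p2
      by (subst p_p1) (simp add: map_smult map_pcompose poly_pcompose map_pCons homs)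
  qed
  have goal: ?case if "poly (map_poly (\<sigma> m) p2) z = 0" "m > 0" for m z
    using transfer[OF that] that unfolding \<sigma>_def by blast
  define S where "S = {i. i < n \<and> coeff p2 i \<noteq> 0}"
  show ?case
  proof (cases "S = {}")
    case True
    interpret idom_hom "\<sigma> 1" by (rule \<sigma>_hom) simp
    have "coeff p2 0 = 0" using True n by (auto simp: S_def)
    hence "poly (map_poly (\<sigma> 1) p2) 0 = 0" by (simp add: poly_0_coeff_0 coeff_map hom_zero del: One_nat_def)
    thus ?thesis by (rule goal) simp
  next
    case False
    \<comment> \<open>\<open>i0\<close> realises the extremal slope of the Newton polygon\<close>
    define val where "val = (\<lambda>i. fls_subdegree (coeff p2 i))"
    define slope :: "nat \<Rightarrow> rat" where "slope = (\<lambda>i. of_int (val i) / of_nat (n - i))"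
    have "finite S" by (simp add: S_def)
    then obtain i0 where i0: "i0 \<in> S" and i0_min: "\<And>i. i \<in> S \<Longrightarrow> slope i0 \<le> slope i"
      using ex_min_if_finite[of "slope ` S"] False by fastforce
    define m where "m = n - i0"
    have m: "m > 0" "i0 < n" "coeff p2 i0 \<noteq> 0" using i0 by (simp_all add: m_def S_def)
    define \<rho> where "\<rho> = val i0"
    have val_ge: "\<rho> * int (n - i) \<le> val i * int m" if "i \<in> S" for i
    proof -
      have "i < n" using that by (simp add: S_def)
      hence "of_int (\<rho> * int (n - i)) \<le> (of_int (val i * int m) :: rat)"
        using i0_min[OF that] m(1) by (simp add: slope_def \<rho>_def m_def field_simps)
      thus ?thesis by (simp only: of_int_le_iff)
    qed
    interpret sm: idom_hom "\<sigma> m" by (rule \<sigma>_hom) (rule m)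
    \<comment> \<open>After \<open>X \<mapsto> X\<^sup>m\<close> the slope \<open>\<rho> / m\<close> becomes the integer \<open>\<rho>\<close>; \<open>c i\<close> are the coefficients of
      \<open>p2(y Y) / y\<^sup>n\<close>.\<close>
    define y :: "'a fls" where "y = fls_X_intpow \<rho>"
    have y: "y \<noteq> 0" "fls_subdegree y = \<rho>" by (simp_all add: y_def)
    define c where "c = (\<lambda>i. \<sigma> m (coeff p2 i) * y ^ i / y ^ n)"
    have c_val: "fls_subdegree (c i) = int m * val i + int i * \<rho> - int n * \<rho>" "c i \<noteq> 0"
      if "coeff p2 i \<noteq> 0" for i
      using that y fls_subdegree_compose_power[OF m(1) that]
      by (simp_all add: c_def \<sigma>_def val_def fls_divide_subdegree fls_subdegree_pow)
    have c_n: "c n = 1" using y by (simp add: c_def p2 sm.hom_one)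
    have c_0: "c i = 0" if "coeff p2 i = 0" for i using that by (simp add: c_def sm.hom_zero)
    have c_int: "fls_subdegree (c i) \<ge> 0" for i
    proof (cases "i \<in> S")
      case True
      hence "i < n" "coeff p2 i \<noteq> 0" by (simp_all add: S_def)
      thus ?thesis using val_ge[OF True] c_val(1)[of i]
        by (simp add: of_nat_diff algebra_simps)
    next
      case nS: False
      show ?thesis
      proof (cases "i = n")
        case True thus ?thesis by (simp add: c_n)
      next
        case False
        hence "coeff p2 i = 0" using nS p2(1) coeff_eq_0[of p2 i] by (force simp: S_def)
        thus ?thesis by (simp add: c_0)
      qed
    qed
    have c_i0: "fls_nth (c i0) 0 \<noteq> 0"
    proof -
      have "fls_subdegree (c i0) = 0"
        using c_val(1)[OF m(3)] m(2) by (simp add: \<rho>_def m_def of_nat_diff algebra_simps)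
      thus ?thesis using c_val(2)[OF m(3)] nth_fls_subdegree_nonzero[of "c i0"] by simp
    qed
    define q where "q = Poly (map (\<lambda>i. fls_regpart (c i)) [0..<Suc n])"
    have c_high: "c i = 0" if "i > n" for i using that p2(1) by (simp add: c_0 coeff_eq_0)
    have coeff_q: "coeff q i = fls_regpart (c i)" for i
      using c_high[of i] by (simp add: q_def nth_default_def del: upt_Suc)
    have q_c: "fps_to_fls (coeff q i) = c i" for i
      by (simp add: coeff_q c_int)
    have q: "degree q = n" "lead_coeff q = 1"
    proof -
      show "degree q = n"
        by (rule antisym[OF degree_le le_degree]) (simp_all add: coeff_q c_high c_n)
      thus "lead_coeff q = 1" by (simp add: coeff_q c_n)
    qed
    define r where "r = map_poly (\<lambda>f. fps_nth f 0) q"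
    have coeff_r: "coeff r i = fls_nth (c i) 0" for i
      by (simp add: r_def coeff_map_poly coeff_q)
    have r: "degree r = n" "lead_coeff r = 1"
    proof -
      show "degree r = n"
        unfolding r_def using q by (subst map_poly_degree_eq) simp_all
      thus "lead_coeff r = 1" by (simp add: coeff_r c_n)
    qed
    obtain b where b: "poly r b = 0"
      using alg_closed_imp_poly_has_root[of r] r n by auto
    define \<mu> where "\<mu> = order b r"
    have "r \<noteq> 0" using r(2) by auto
    then obtain h where h: "r = [:- b, 1:] ^ \<mu> * h" "\<not> [:- b, 1:] dvd h"
      using order_decomp unfolding \<mu>_def by blast
    define g where "g = [:- b, 1:] ^ \<mu>"
    have g: "lead_coeff g = 1" "degree g = \<mu>"
      using lead_coeff_power[of "[:- b, 1:]" \<mu>] by (simp_all add: g_def degree_linear_power)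
    have h_monic: "lead_coeff h = 1"
      using r(2) h(1) g(1) by (simp add: g_def[symmetric] lead_coeff_mult)
    have \<mu>: "\<mu> > 0" using b \<open>r \<noteq> 0\<close> by (simp add: \<mu>_def order_gt_0_iff)
    have deg_sum: "n = \<mu> + degree h"
      using r(1) h(1) g h_monic \<open>r \<noteq> 0\<close> by (metis degree_mult_eq g_def mult_eq_0_iff)
    have "degree h > 0"
    proof (rule ccontr)
      assume "\<not> degree h > 0"
      hence "h = 1" using h_monic by (metis degree_eq_zeroE gr0I lead_coeff_pCons(2) one_pCons)
      hence r_pow: "r = [:- b, 1:] ^ n" using h(1) deg_sum by simp
      hence "of_nat n * - b = coeff r (n - 1)" using linear_power_lower_coeff[OF n, of "- b"] by simp
      also have "\<dots> = 0" using c_0[OF p2_below] by (simp add: coeff_r)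
      finally have "b = 0" using of_nat_n by simp
      hence "r = monom 1 n" by (simp add: r_pow monom_altdef)
      hence "coeff r i0 = 0" using m(2) by simp
      thus False using c_i0 by (simp add: coeff_r)
    qed
    obtain u v where "g * u + h * v = 1"
      using bezout_linear_power[of h b \<mu>] h(2) by (auto simp: poly_eq_0_iff_dvd g_def)
    then obtain G H where GH: "q = G * H" "degree G = degree g"
      using hensel_factorisation[OF q(2) _ g(1) h_monic] h(1) by (metis g_def r_def)
    interpret emb: idom_hom "fps_to_fls :: 'a fps \<Rightarrow> 'a fls"
      by standard (simp_all add: fls_times_fps_to_fls)
    define G' where "G' = map_poly fps_to_fls G"
    have "degree G' = \<mu>"
      unfolding G'_def using GH(2) g(2) \<mu> by (subst map_poly_degree_eq) auto
    then obtain l z where l: "l > 0" and z: "poly (map_poly (\<sigma> l) G') z = 0"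
      using less.hyps[of G'] \<mu> deg_sum \<open>degree h > 0\<close> unfolding n_def \<sigma>_def by auto
    interpret sl: idom_hom "\<sigma> l" by (rule \<sigma>_hom) (rule l)
    define q' where "q' = map_poly fps_to_fls q"
    have "poly (map_poly (\<sigma> l) q') z = 0"
      using z by (simp add: q'_def GH(1) emb.map_mult sl.map_mult G'_def[symmetric])
    moreover have "degree (map_poly (\<sigma> l) q') \<le> n"
      using q by (intro degree_le) (simp add: sl.coeff_map q'_def emb.coeff_map coeff_eq_0
          sl.hom_zero)
    ultimately have sum0: "(\<Sum>i\<le>n. \<sigma> l (c i) * z ^ i) = 0"
      by (simp add: poly_eq_sum_le sl.coeff_map q'_def emb.coeff_map q_c)
    define Y where "Y = \<sigma> l y"
    have "map_poly (\<sigma> (m * l)) p2 = map_poly (\<sigma> l) (map_poly (\<sigma> m) p2)"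
      using m(1) l by (intro poly_eqI)
        (simp add: coeff_map_poly \<sigma>_def fls_compose_power_twice)
    moreover have "degree (map_poly (\<sigma> l) (map_poly (\<sigma> m) p2)) \<le> n"
      using p2(1) by (intro degree_le) (simp add: sl.coeff_map sm.coeff_map coeff_eq_0 sm.hom_zero sl.hom_zero)
    ultimately have "poly (map_poly (\<sigma> (m * l)) p2) (Y * z) =
        (\<Sum>i\<le>n. \<sigma> l (\<sigma> m (coeff p2 i)) * (Y * z) ^ i)"
      by (simp add: poly_eq_sum_le sl.coeff_map sm.coeff_map)
    also have "\<dots> = (\<Sum>i\<le>n. Y ^ n * (\<sigma> l (c i) * z ^ i))"
    proof (rule sum.cong[OF refl])
      fix i
      have "\<sigma> m (coeff p2 i) * y ^ i = y ^ n * c i" using y by (simp add: c_def)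
      hence "\<sigma> l (\<sigma> m (coeff p2 i)) * Y ^ i = Y ^ n * \<sigma> l (c i)"
        unfolding Y_def sl.hom_mult[symmetric] sl.hom_power[symmetric] by simp
      thus "\<sigma> l (\<sigma> m (coeff p2 i)) * (Y * z) ^ i = Y ^ n * (\<sigma> l (c i) * z ^ i)"
        by (simp add: power_mult_distrib mult.assoc[symmetric])
    qed
    also have "\<dots> = 0" by (simp add: sum_distrib_left[symmetric] sum0)
    finally show ?thesis using m(1) l by (intro goal[of "m * l" "Y * z"]) auto
  qed
qed


section \<open>Derivations of Laurent series that preserve the order\<close>

definition fls_map :: "('a::zero \<Rightarrow> 'a) \<Rightarrow> 'a fls \<Rightarrow> 'a fls" where
  "fls_map d f = Abs_fls (\<lambda>n. d (fls_nth f n))"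

lemma fls_nth_map:
  assumes "d 0 = 0"
  shows "fls_nth (fls_map d f) n = d (fls_nth f n)"
  unfolding fls_map_def
  by (rule nth_Abs_fls_lower_bound[of "fls_subdegree f"]) (simp add: assms)

text \<open>
  The coefficient formula for products with bounds below the actual orders: a derivation may raise
  the order, and the sums in the Leibniz rule need a common index set.
\<close>

lemma fls_times_nth_wide:
  fixes f g :: "'a::comm_ring_1 fls"
  assumes f: "\<And>k. k < A \<Longrightarrow> fls_nth f k = 0" and g: "\<And>k. k < B \<Longrightarrow> fls_nth g k = 0"
  shows "fls_nth (f * g) n = (\<Sum>i=A..n - B. fls_nth f i * fls_nth g (n - i))"
proof (cases "f = 0 \<or> g = 0")
  case False
  hence "A \<le> fls_subdegree f" "B \<le> fls_subdegree g"
    using f g by (auto intro: fls_subdegree_geI)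
  hence sub: "{fls_subdegree f..n - fls_subdegree g} \<subseteq> {A..n - B}" by auto
  show ?thesis
    unfolding fls_times_nth(2) by (rule sum.mono_neutral_left[OF _ sub]) auto
qed auto

text \<open>
  The derivation of Laurent series that restricts to \<open>d\<close> on constants and maps the variable to \<open>g\<close>.
\<close>

definition fls_derivation :: "('a::comm_ring_1 \<Rightarrow> 'a) \<Rightarrow> 'a fls \<Rightarrow> 'a fls \<Rightarrow> 'a fls" where
  "fls_derivation d g f = fls_map d f + g * fls_deriv f"

lemma differential_field_fls:
  fixes d :: "'a::field \<Rightarrow> 'a"
  assumes "differential_field d"
  shows "differential_field (fls_derivation d g)"
proof -
  interpret d: derivation_along "\<lambda>x. x" d
    using assms by (simp add: differential_field_derivation)
  note nth = fls_nth_map[where d = d, OF d.der_zero]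
  have d_sum: "d (sum f A) = (\<Sum>a\<in>A. d (f a))" for f :: "int \<Rightarrow> 'a" and A
    by (induction A rule: infinite_finite_induct) (simp_all add: d.der_zero d.der_add)
  have map_add: "fls_map d (x + y) = fls_map d x + fls_map d y" for x y
    by (rule fls_eqI) (simp add: nth d.der_add)
  have map_mult: "fls_map d (x * y) = fls_map d x * y + x * fls_map d y" for x y
  proof (rule fls_eqI)
    fix n
    define A B where "A = fls_subdegree x" and "B = fls_subdegree y"
    have low: "k < A \<Longrightarrow> fls_nth x k = 0" "k < B \<Longrightarrow> fls_nth y k = 0" for k
      by (simp_all add: A_def B_def)
    have low': "k < A \<Longrightarrow> fls_nth (fls_map d x) k = 0" "k < B \<Longrightarrow> fls_nth (fls_map d y) k = 0" for k
      by (simp_all add: low nth d.der_zero)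
    have "fls_nth (x * y) n = (\<Sum>i=A..n - B. fls_nth x i * fls_nth y (n - i))"
      by (rule fls_times_nth_wide) (simp_all add: low)
    moreover have "fls_nth (fls_map d x * y) n = (\<Sum>i=A..n - B. d (fls_nth x i) * fls_nth y (n - i))"
      by (subst fls_times_nth_wide[of A _ B]) (simp_all add: low low' nth d.der_zero)
    moreover have "fls_nth (x * fls_map d y) n = (\<Sum>i=A..n - B. fls_nth x i * d (fls_nth y (n - i)))"
      by (subst fls_times_nth_wide[of A _ B]) (simp_all add: low low' nth d.der_zero)
    ultimately show "fls_nth (fls_map d (x * y)) n = fls_nth (fls_map d x * y + x * fls_map d y) n"
      by (simp add: nth d_sum d.der_mult sum.distrib)
  qed
  show ?thesis
    by unfold_locales (simp_all add: fls_derivation_def map_add map_mult fls_deriv_mult algebra_simps)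
qed

lemma fls_derivation_const:
  assumes "d 0 = 0"
  shows "fls_derivation d g (fls_const c) = fls_const (d c)"
  unfolding fls_derivation_def by (rule fls_eqI) (simp add: fls_nth_map assms)

lemma fls_derivation_X_power:
  assumes "differential_field d"
  shows "fls_derivation d g (fls_X ^ n) = g * (of_nat n * fls_X ^ (n - 1))"
proof -
  interpret d: derivation_along "\<lambda>x. x" d
    using assms by (simp add: differential_field_derivation)
  have "fls_map d (fls_X ^ n) = 0"
    by (rule fls_eqI) (simp add: fls_nth_map d.der_zero d.der_one fls_X_power_nth)
  thus ?thesis by (simp add: fls_derivation_def fls_deriv_X_power)
qed

text \<open>
  As \<open>g\<close> has positive order, multiplying by it compensates for the order lost in \<open>d/dX\<close>.
\<close>

lemma fls_derivation_low:
  assumes "d 0 = 0" "fls_nth g 0 = 0" "fls_subdegree g \<ge> 0"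
    and "\<And>k. k < N \<Longrightarrow> fls_nth f k = 0" "n < N"
  shows "fls_nth (fls_derivation d g f) n = 0"
proof -
  have g: "fls_nth g k = 0" if "k < 1" for k
    using that assms(2,3) fls_eq0_below_subdegree[of k g] by (cases "k = 0") auto
  have f': "fls_nth (fls_deriv f) k = 0" if "k < N - 1" for k
    using that assms(4) by simp
  have "fls_nth (g * fls_deriv f) n = (\<Sum>i=1..n - (N - 1). fls_nth g i * fls_nth (fls_deriv f) (n - i))"
    by (rule fls_times_nth_wide[OF g f'])
  also have "\<dots> = 0" using assms(5) by simp
  finally show ?thesis
    using assms by (simp add: fls_derivation_def fls_nth_map)
qed

lemma fls_derivation_nth_0:
  assumes "d 0 = 0" "fls_nth g 0 = 0" "fls_subdegree g \<ge> 0" "fls_subdegree f \<ge> 0"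
  shows "fls_nth (fls_derivation d g f) 0 = d (fls_nth f 0)"
proof -
  have g: "fls_nth g k = 0" if "k < 1" for k
    using that assms(2,3) fls_eq0_below_subdegree[of k g] by (cases "k = 0") auto
  have f': "fls_nth (fls_deriv f) k = 0" if "k < 0" for k
    using that assms(4) by (cases "k = -1") auto
  have "fls_nth (g * fls_deriv f) 0 = (\<Sum>i=1..0 - 0. fls_nth g i * fls_nth (fls_deriv f) (0 - i))"
    by (rule fls_times_nth_wide[OF g f'])
  thus ?thesis by (simp add: fls_derivation_def fls_nth_map assms)
qed

section \<open>Local solutions are unramified over the roots\<close>

lemma fls_nth_0_mult:
  fixes f g :: "'a::field fls"
  assumes "fls_subdegree f \<ge> 0" "fls_subdegree g \<ge> 0"
  shows "fls_nth (f * g) 0 = fls_nth f 0 * fls_nth g 0"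
  using fls_times_nth_wide[of 0 f 0 g 0] assms by simp

lemma fls_nth_0_prod:
  fixes f :: "'b \<Rightarrow> 'a::field fls"
  assumes "\<And>a. a \<in> A \<Longrightarrow> fls_subdegree (f a) \<ge> 0"
  shows "fls_nth (\<Prod>a\<in>A. f a) 0 = (\<Prod>a\<in>A. fls_nth (f a) 0) \<and> fls_subdegree (\<Prod>a\<in>A. f a) \<ge> 0"
  using assms
proof (induction A rule: infinite_finite_induct)
  case (insert a A)
  thus ?case
    by (simp add: fls_nth_0_mult fls_mult_subdegree_ge_0)
qed simp_all

lemma fls_subdegree_prod_nonzero:
  fixes f :: "'b \<Rightarrow> 'a::field fls"
  assumes "finite A" "\<And>a. a \<in> A \<Longrightarrow> f a \<noteq> 0"
  shows "fls_subdegree (\<Prod>a\<in>A. f a) = (\<Sum>a\<in>A. fls_subdegree (f a)) \<and> (\<Prod>a\<in>A. f a) \<noteq> 0"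
  using assms by (induction A) auto

text \<open>
  The order comparison of the opening remarks. Here \<open>v c\<close> is the order of \<open>z - c\<close> and \<open>w\<close> that of the
  derivative of \<open>z\<close>; the equation gives \<open>2 w = \<Sum>\<^sub>c v c\<close>, and \<open>w \<ge> v c\<close> for each root \<open>c\<close>. Two of the
  orders can only differ when both are nonnegative, and at most one is positive, as the roots are
  distinct. With at least three roots, all orders vanish.
\<close>

theorem residue_of_local_solution:
  fixes d :: "'a::field \<Rightarrow> 'a"
  assumes d: "differential_field d" and g: "fls_nth g 0 = 0" "fls_subdegree g \<ge> 0"
    and S: "finite S" "card S \<ge> 3" "\<And>c. c \<in> S \<Longrightarrow> d c = 0" and l: "l \<noteq> 0"
    and eq: "(fls_derivation d g z)\<^sup>2 = fls_const l * (\<Prod>c\<in>S. z - fls_const c)"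
    and nz: "fls_derivation d g z \<noteq> 0"
  shows "fls_subdegree z \<ge> 0"
    and "(d (fls_nth z 0))\<^sup>2 = l * (\<Prod>c\<in>S. fls_nth z 0 - c)"
    and "\<And>c. c \<in> S \<Longrightarrow> fls_nth z 0 \<noteq> c"
proof -
  interpret d: derivation_along "\<lambda>x. x" d
    using d by (simp add: differential_field_derivation)
  define \<Delta> where "\<Delta> = fls_derivation d g"
  interpret \<Delta>: derivation_along "\<lambda>x. x" \<Delta>
    unfolding \<Delta>_def using differential_field_fls[OF d] by (simp add: differential_field_derivation)
  define v where "v = (\<lambda>c. fls_subdegree (z - fls_const c))"
  have ne: "z - fls_const c \<noteq> 0" if "c \<in> S" for c
  proof
    assume "z - fls_const c = 0"
    hence "z = fls_const c" by simp
    thus False using nz S(3)[OF that] by (simp add: fls_derivation_const d.der_zero)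
  qed
  have \<Delta>_shift: "\<Delta> (z - fls_const c) = \<Delta> z" if "c \<in> S" for c
  proof -
    have "\<Delta> (fls_const c) = 0"
      using S(3)[OF that] by (simp add: \<Delta>_def fls_derivation_const d.der_zero)
    thus ?thesis using \<Delta>.der_add[of "z - fls_const c" "fls_const c"] by simp
  qed
  define w where "w = fls_subdegree (\<Delta> z)"
  have w_ge: "w \<ge> v c" if "c \<in> S" for c
    unfolding w_def v_def \<Delta>_shift[OF that, symmetric]
  proof (rule fls_subdegree_geI)
    show "\<Delta> (z - fls_const c) \<noteq> 0" using nz \<Delta>_shift[OF that] by (simp add: \<Delta>_def)
    fix k assume "k < fls_subdegree (z - fls_const c)"
    thus "fls_nth (\<Delta> (z - fls_const c)) k = 0"
      unfolding \<Delta>_def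
      by (intro fls_derivation_low[where d = d, OF d.der_zero g fls_eq0_below_subdegree])
  qed
  have two_w: "2 * w = (\<Sum>c\<in>S. v c)"
  proof -
    have "2 * w = fls_subdegree ((\<Delta> z)\<^sup>2)" by (simp add: w_def fls_subdegree_pow)
    also have "\<dots> = (\<Sum>c\<in>S. v c)"
      using fls_subdegree_prod_nonzero[OF S(1), of "\<lambda>c. z - fls_const c"] ne l
      by (simp add: eq[folded \<Delta>_def] v_def fls_const_nonzero)
    finally show ?thesis .
  qed
  have const_diff: "v c = v b" if "v b < 0" for b c
  proof -
    have "z - fls_const c = (z - fls_const b) + fls_const (b - c)" by (simp add: fls_minus_const[symmetric])
    moreover have "z - fls_const b \<noteq> 0" using that by (auto simp: v_def)
    ultimately show ?thesis using that unfolding v_def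
      by (metis fls_subdegree_add_eq1 fls_const_subdegree)
  qed
  have nonneg: "v b \<ge> 0" if "b \<in> S" for b
  proof (rule ccontr)
    assume *: "\<not> v b \<ge> 0"
    have "(\<Sum>c\<in>S. v c) = (\<Sum>c\<in>S. v b)"
      using * by (intro sum.cong refl const_diff) simp
    hence "2 * w = int (card S) * v b" by (simp add: two_w)
    moreover have "int (card S) * v b \<le> 3 * v b"
      using * S(2) by (intro mult_right_mono_neg) auto
    ultimately show False using w_ge[OF that] * by simp
  qed
  have pos_unique: "v c = 0" if "v b > 0" "b \<noteq> c" for b c
  proof -
    have "z - fls_const c = fls_const (b - c) + (z - fls_const b)" by (simp add: fls_minus_const[symmetric])
    moreover have "fls_const (b - c) \<noteq> 0" using that by (simp add: fls_const_nonzero)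
    ultimately show ?thesis using that unfolding v_def
      by (metis fls_subdegree_add_eq1 fls_const_subdegree)
  qed
  have v0: "v b = 0" if "b \<in> S" for b
  proof (rule ccontr)
    assume *: "v b \<noteq> 0"
    hence pos: "v b > 0" using nonneg[OF that] by simp
    have "(\<Sum>c\<in>S. v c) = v b + (\<Sum>c\<in>S - {b}. v c)" using S(1) that by (rule sum.remove)
    also have "(\<Sum>c\<in>S - {b}. v c) = 0" using pos_unique[OF pos] by (intro sum.neutral) (metis DiffE insertI1)
    finally show False using two_w w_ge[OF that] pos by simp
  qed
  obtain b where b: "b \<in> S" using S(2) by fastforce
  show z: "fls_subdegree z \<ge> 0"
  proof (rule fls_subdegree_ge0I)
    fix k :: int assume "k < 0"
    hence "fls_nth (z - fls_const b) k = 0" using v0[OF b] by (simp add: v_def del: fls_minus_nth)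
    thus "fls_nth z k = 0" using \<open>k < 0\<close> by simp
  qed
  show ne0: "fls_nth z 0 \<noteq> c" if "c \<in> S" for c
  proof
    assume "fls_nth z 0 = c"
    hence "fls_nth (z - fls_const c) (v c) = 0" by (simp add: v0[OF that])
    thus False using ne[OF that] by (simp add: v_def del: fls_minus_nth)
  qed
  have "w = 0" using two_w v0 by simp
  hence "fls_nth ((\<Delta> z)\<^sup>2) 0 = (fls_nth (\<Delta> z) 0)\<^sup>2"
    by (simp add: power2_eq_square fls_nth_0_mult w_def)
  also have "fls_nth (\<Delta> z) 0 = d (fls_nth z 0)"
    unfolding \<Delta>_def by (rule fls_derivation_nth_0[where d = d, OF d.der_zero g z])
  finally have "(d (fls_nth z 0))\<^sup>2 = fls_nth (fls_const l * (\<Prod>c\<in>S. z - fls_const c)) 0"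
    by (simp add: eq[folded \<Delta>_def])
  also have "\<dots> = l * (\<Prod>c\<in>S. fls_nth z 0 - c)"
    using fls_nth_0_prod[of S "\<lambda>c. z - fls_const c"] v0
    by (simp add: v_def)
  finally show "(d (fls_nth z 0))\<^sup>2 = l * (\<Prod>c\<in>S. fls_nth z 0 - c)" .
qed


section \<open>Points with the same algebraic relations\<close>

text \<open>
  If \<open>p\<close> is a relation of least degree for \<open>x\<close>, every relation for \<open>x\<close> is, up to a factor from \<open>R\<close>, a
  multiple of \<open>p\<close>, and hence a relation for every root \<open>y\<close> of \<open>p\<close>.
\<close>

lemma relations_transfer:
  fixes e1 :: "'r::idom \<Rightarrow> 'a::field" and e2 :: "'r \<Rightarrow> 'b::field"
  assumes R: "subring_set R" and e: "idom_hom e1" "idom_hom e2"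
    and inj: "\<And>a. a \<in> R \<Longrightarrow> e2 a = 0 \<Longrightarrow> a = 0"
    and p: "poly_over R p" "p \<noteq> 0" "poly (map_poly e1 p) x = 0" "poly (map_poly e2 p) y = 0"
    and min: "\<And>q. poly_over R q \<Longrightarrow> q \<noteq> 0 \<Longrightarrow> poly (map_poly e1 q) x = 0 \<Longrightarrow> degree p \<le> degree q"
    and q: "poly_over R q" "poly (map_poly e1 q) x = 0"
  shows "poly (map_poly e2 q) y = 0"
proof -
  interpret E1: idom_hom "\<lambda>p. poly (map_poly e1 p) x" by (rule idom_hom.eval_hom) (rule e)
  interpret E2: idom_hom "\<lambda>p. poly (map_poly e2 p) y" by (rule idom_hom.eval_hom) (rule e)
  interpret e1: idom_hom e1 by (rule e)
  interpret e2: idom_hom e2 by (rule e)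
  obtain j g r where gr: "poly_over R g" "poly_over R r" "smult (lead_coeff p ^ j) q = p * g + r"
    "r = 0 \<or> degree r < degree p"
    by (rule pseudo_division[OF R p(1,2) q(1)])
  have "poly (map_poly e1 (smult (lead_coeff p ^ j) q)) x = 0"
    by (simp add: e1.map_smult q(2))
  hence "poly (map_poly e1 r) x = 0"
    unfolding gr(3) E1.hom_add E1.hom_mult using p(3) by simp
  hence "r = 0" using gr(4) min[OF gr(2)] by linarith
  have "e2 (lead_coeff p ^ j) * poly (map_poly e2 q) y = 0"
    using arg_cong[OF gr(3), of "\<lambda>q. poly (map_poly e2 q) y"] p(4) \<open>r = 0\<close>
    by (simp add: e2.map_smult e2.map_mult)
  moreover have "e2 (lead_coeff p) \<noteq> 0"
    using inj[of "lead_coeff p"] p(1,2) by (auto simp: poly_over_def)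
  ultimately show ?thesis by (simp add: e2.hom_power)
qed

text \<open>
  The converse direction uses that \<open>p\<close> is irreducible: a relation \<open>p1\<close> of least degree for \<open>y\<close> divides
  \<open>p\<close> up to a factor from \<open>R\<close>, and as the cofactor has smaller degree it cannot vanish at \<open>x\<close>, so \<open>p1\<close> does.
\<close>

lemma relations_agree:
  fixes e1 :: "'r::idom \<Rightarrow> 'a::field" and e2 :: "'r \<Rightarrow> 'b::field"
  assumes R: "subring_set R" and e: "idom_hom e1" "idom_hom e2"
    and inj: "\<And>a. a \<in> R \<Longrightarrow> e1 a = 0 \<Longrightarrow> a = 0" "\<And>a. a \<in> R \<Longrightarrow> e2 a = 0 \<Longrightarrow> a = 0"
    and p: "poly_over R p" "p \<noteq> 0" "poly (map_poly e1 p) x = 0" "poly (map_poly e2 p) y = 0"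
    and min: "\<And>q. poly_over R q \<Longrightarrow> q \<noteq> 0 \<Longrightarrow> poly (map_poly e1 q) x = 0 \<Longrightarrow> degree p \<le> degree q"
    and q: "poly_over R q"
  shows "poly (map_poly e1 q) x = 0 \<longleftrightarrow> poly (map_poly e2 q) y = 0"
proof
  assume qx: "poly (map_poly e1 q) x = 0"
  show "poly (map_poly e2 q) y = 0"
    by (rule relations_transfer[OF R e _ p _ q qx]) (use inj(2) min in blast)+
next
  assume qy: "poly (map_poly e2 q) y = 0"
  interpret e1: idom_hom e1 by (rule e)
  interpret e2: idom_hom e2 by (rule e)
  define good where "good = (\<lambda>q. poly_over R q \<and> q \<noteq> 0 \<and> poly (map_poly e2 q) y = 0)"
  obtain p1 where p1: "good p1" and min1: "\<And>q. good q \<Longrightarrow> degree p1 \<le> degree q"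
    using ex_has_least_nat[of good p degree] p by (auto simp: good_def)
  obtain j g r where gr: "poly_over R g" "poly_over R r" "smult (lead_coeff p1 ^ j) p = p1 * g + r"
    "r = 0 \<or> degree r < degree p1"
    by (rule pseudo_division[OF R _ _ p(1), of p1]) (use p1 in \<open>auto simp: good_def\<close>)
  have "poly (map_poly e2 (smult (lead_coeff p1 ^ j) p)) y = 0"
    by (simp add: e2.map_smult p(4))
  hence "poly (map_poly e2 r) y = 0"
    using p1 unfolding gr(3) e2.map_add e2.map_mult good_def by simp
  hence "r = 0" using gr(2,4) min1[of r] by (fastforce simp: good_def)
  have lead: "lead_coeff p1 ^ j \<noteq> 0" using p1 by (simp add: good_def)
  have deg1: "degree p1 > 0"
  proof (rule ccontr)
    assume "\<not> degree p1 > 0"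
    then obtain a where a: "p1 = [:a:]" by (auto elim: degree_eq_zeroE)
    hence "e2 a = 0" "a \<in> R" "a \<noteq> 0" using p1 by (auto simp: good_def e2.map_pCons poly_over_pCons)
    thus False using inj(2) by blast
  qed
  have "g \<noteq> 0" using gr(3) \<open>r = 0\<close> lead p(2) by auto
  hence "degree p = degree p1 + degree g"
    using arg_cong[OF gr(3), of degree] lead \<open>r = 0\<close> p1 by (simp add: degree_mult_eq good_def)
  hence "poly (map_poly e1 g) x \<noteq> 0"
    using min[OF gr(1) \<open>g \<noteq> 0\<close>] deg1 by linarith
  moreover have "poly (map_poly e1 p1) x * poly (map_poly e1 g) x = 0"
    using arg_cong[OF gr(3), of "\<lambda>q. poly (map_poly e1 q) x"] \<open>r = 0\<close> p(3)
    by (simp add: e1.map_smult e1.map_mult)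
  ultimately have p1x: "poly (map_poly e1 p1) x = 0" by simp
  show "poly (map_poly e1 q) x = 0"
    by (rule relations_transfer[OF R e(2,1) _ _ _ _ p1x _ q qy])
      (use inj(1) p1 min1 in \<open>auto simp: good_def\<close>)
qed

text \<open>
  Makes a relation over \<open>k[T]\<close> survive the substitution \<open>T = 0\<close>.
\<close>

lemma factor_out_indeterminate:
  fixes q :: "'a::field poly poly"
  assumes k: "subring_set k" and q: "q \<noteq> 0" "poly_over {f. poly_over k f} q"
  obtains j q' where "q = smult ([:0, 1:] ^ j) q'" "poly_over {f. poly_over k f} q'"
    "map_poly (\<lambda>f. poly f 0) q' \<noteq> 0"
proof -
  have "\<exists>j q'. q = smult ([:0, 1:] ^ j) q' \<and> poly_over {f. poly_over k f} q' \<and>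
    map_poly (\<lambda>f. poly f 0) q' \<noteq> 0"
    using q
  proof (induction "degree (lead_coeff q)" arbitrary: q rule: less_induct)
    case less
    show ?case
    proof (cases "map_poly (\<lambda>f. poly f 0) q = 0")
      case False
      thus ?thesis using less.prems by (intro exI[of _ 0] exI[of _ q]) simp
    next
      case True
      have "coeff (coeff q i) 0 = 0" for i
        using arg_cong[OF True, of "\<lambda>r. coeff r i"] by (simp add: coeff_map_poly poly_0_coeff_0)
      hence shift: "pCons 0 (poly_shift (Suc 0) (coeff q i)) = coeff q i" for i
        by (intro poly_eqI) (simp add: coeff_pCons coeff_poly_shift split: nat.splits)
      define q' where "q' = map_poly (poly_shift (Suc 0)) q"
      have coeff_q': "coeff q' i = poly_shift (Suc 0) (coeff q i)" for i
        by (simp add: q'_def coeff_map_poly)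
      have q_q': "q = smult [:0, 1:] q'"
        by (rule poly_eqI) (simp add: coeff_q' shift)
      have "q' \<noteq> 0" using q_q' less.prems(1) by auto
      have "degree q = degree q'" by (subst q_q') simp
      hence "lead_coeff q = pCons 0 (lead_coeff q')" by (simp add: coeff_q' shift)
      hence "degree (lead_coeff q') < degree (lead_coeff q)" using \<open>q' \<noteq> 0\<close> by simp
      moreover have "poly_over {f. poly_over k f} q'"
        using less.prems(2) by (simp add: poly_over_def coeff_q' coeff_poly_shift)
      ultimately obtain j q'' where *: "q' = smult ([:0, 1:] ^ j) q''"
        "poly_over {f. poly_over k f} q''" "map_poly (\<lambda>f. poly f 0) q'' \<noteq> 0"
        using less.hyps[of q'] \<open>q' \<noteq> 0\<close> by blast
      have "q = smult ([:0, 1:] ^ Suc j) q''" by (subst q_q', subst *(1)) (simp add: mult.commute)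
      thus ?thesis using * by blast
    qed
  qed
  thus thesis using that by blast
qed

section \<open>Specialising a primitive or exponential generator\<close>

lemma fls_const_hom: "idom_hom (fls_const :: 'a::idom \<Rightarrow> 'a fls)"
  by standard (simp_all add: fls_plus_const fls_const_mult_const)

text \<open>
  The substitution \<open>T = X\<^sup>m\<close>, under which \<open>X\<close> becomes an \<open>m\<close>-th root of the generator \<open>t\<close>.
\<close>

definition ramified_eval :: "nat \<Rightarrow> 'a::field poly \<Rightarrow> 'a fls" where
  "ramified_eval m f = poly (map_poly fls_const f) (fls_X ^ m)"

lemma ramified_eval_hom: "idom_hom (ramified_eval m :: 'a::field poly \<Rightarrow> 'a fls)"
  unfolding ramified_eval_def by (rule idom_hom.eval_hom) (rule fls_const_hom)

lemma ramified_eval_1: "ramified_eval 1 f = fps_to_fls (fps_of_poly f)"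
proof -
  interpret idom_hom "fls_const :: 'a \<Rightarrow> 'a fls" by (rule fls_const_hom)
  show ?thesis
    unfolding ramified_eval_def
    by (induction f) (simp_all add: map_pCons fps_of_poly_pCons fls_times_fps_to_fls mult.commute)
qed

lemma ramified_eval_compose_power:
  assumes "m > 0"
  shows "ramified_eval m f = fls_compose_power (ramified_eval 1 f) m"
proof -
  interpret c: idom_hom "fls_const :: 'a \<Rightarrow> 'a fls" by (rule fls_const_hom)
  interpret s: idom_hom "\<lambda>f :: 'a fls. fls_compose_power f m" by (rule fls_compose_power_hom) (rule assms)
  show ?thesis
    unfolding ramified_eval_def
  proof (induction f)
    case (pCons a f)
    thus ?case using assms
      by (simp add: c.map_pCons fls_X_power_conv_shift_1)
  qed (use assms in simp)
qed

lemma ramified_eval_props: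
  assumes "m > 0"
  shows "ramified_eval m f = 0 \<longleftrightarrow> f = 0" "fls_subdegree (ramified_eval m f) \<ge> 0"
    "fls_nth (ramified_eval m f) 0 = poly f 0"
proof -
  note eq = ramified_eval_compose_power[OF assms, of f] ramified_eval_1[of f]
  show "ramified_eval m f = 0 \<longleftrightarrow> f = 0"
    using fls_subdegree_compose_power(2)[OF assms, of "ramified_eval 1 f"] by (auto simp: eq simp del: One_nat_def)
  show "fls_nth (ramified_eval m f) 0 = poly f 0"
    using assms by (simp add: eq fls_nth_compose_power poly_0_coeff_0 del: One_nat_def)
  show "fls_subdegree (ramified_eval m f) \<ge> 0"
  proof (cases "f = 0")
    case False
    thus ?thesis
      using fls_subdegree_compose_power(1)[OF assms, of "ramified_eval 1 f"]
      by (simp add: eq fls_subdegree_fls_to_fps_gt0 del: One_nat_def)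
  qed (simp add: ramified_eval_def)
qed

lemma fls_nth_0_poly:
  fixes z :: "'a::field fls"
  assumes "fls_subdegree z \<ge> 0" "\<And>i. fls_subdegree (coeff q i) \<ge> 0"
  shows "fls_nth (poly q z) 0 = poly (map_poly (\<lambda>f. fls_nth f 0) q) (fls_nth z 0) \<and>
    fls_subdegree (poly q z) \<ge> 0"
  using assms(2)
proof (induction q)
  case (pCons a q)
  have a: "fls_subdegree a \<ge> 0" using pCons.prems[of 0] by simp
  have q: "fls_subdegree (coeff q i) \<ge> 0" for i using pCons.prems[of "Suc i"] by simp
  note IH = pCons.IH[OF q]
  have zq: "fls_subdegree (z * poly q z) \<ge> 0"
    using IH assms(1) by (simp add: fls_mult_subdegree_ge_0)
  have "fls_subdegree (a + z * poly q z) \<ge> 0"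
    using a zq by (intro fls_subdegree_ge0I) simp
  thus ?case
    using IH assms(1) by (simp add: map_poly_pCons fls_nth_0_mult)
qed simp

text \<open>
  If evaluation intertwines \<open>d\<close> with a derivation \<open>\<delta>\<close> of the coefficient ring, the derivative at an
  algebraic point is governed by polynomials alone. The same \<open>\<delta>\<close> will serve at \<open>t\<close> and at \<open>X\<^sup>m\<close>.
\<close>

lemma derivation_of_evaluation:
  fixes d :: "'a::field \<Rightarrow> 'a"
  assumes d: "differential_field d" and e: "idom_hom e"
    and comm: "\<And>f. d (e f) = e (\<delta> f)" "\<delta> 0 = 0"
  shows "d (poly (map_poly e p) x) =
    poly (map_poly e (map_poly \<delta> p)) x + poly (map_poly e (pderiv p)) x * d x"
proof -
  interpret d: derivation_along "\<lambda>x. x" d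
    using d by (simp add: differential_field_derivation)
  interpret e: idom_hom e by (rule e)
  have "map_poly d (map_poly e p) = map_poly e (map_poly \<delta> p)"
    by (rule poly_eqI) (simp add: coeff_map_poly d.der_zero e.hom_zero comm)
  thus ?thesis using d.chain_rule[of "map_poly e p" x] by (simp add: e.map_pderiv)
qed

text \<open>
  The transcendental step of the descent. A relation \<open>p\<close> of least degree between \<open>t\<close> and \<open>y\<close> has a
  Puiseux root \<open>z\<close>. Differentiating \<open>p(y) = 0\<close> expresses the differential equation for \<open>y\<close> as a further
  polynomial relation \<open>q = (\<delta> p)\<^sup>2 - P p\<^sub>Y\<^sup>2\<close>; as \<open>z\<close> satisfies the same relations, and \<open>p\<^sub>Y\<close> does not
  vanish at \<open>z\<close>, the equation also holds for \<open>z\<close>.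
\<close>

theorem solution_specialises:
  fixes D :: "'a::alg_closed_field \<Rightarrow> 'a"
  assumes D: "differential_field D" and char: "CHAR('a) = 0"
    and k: "subring_set k" "\<And>x. x \<in> k \<Longrightarrow> D x \<in> k"
    and t: "D t = t * poly h t" "poly_over k h"
    and transc: "\<And>f. poly_over k f \<Longrightarrow> poly f t = 0 \<Longrightarrow> f = 0"
    and S: "finite S" "card S \<ge> 3" "\<And>c. c \<in> S \<Longrightarrow> D c = 0" "S \<subseteq> k" and l: "l \<noteq> 0" "l \<in> k"
    and sol: "(D y)\<^sup>2 = l * (\<Prod>c\<in>S. y - c)" "D y \<noteq> 0"
    and alg: "poly_over {f. poly_over k f} q0" "q0 \<noteq> 0" "poly (map_poly (\<lambda>f. poly f t) q0) y = 0"
  obtains p a where "poly_over k p" "p \<noteq> 0" "poly p a = 0"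
    "(D a)\<^sup>2 = l * (\<Prod>c\<in>S. a - c)" "D a \<noteq> 0"
proof -
  interpret D: derivation_along "\<lambda>x. x" D
    using D by (simp add: differential_field_derivation)
  define R where "R = {f. poly_over k f}"
  have R: "subring_set R" unfolding R_def by (rule subring_set_poly_over) (rule k)
  define \<epsilon> where "\<epsilon> = (\<lambda>f. poly f t)"
  interpret \<epsilon>: idom_hom \<epsilon> by standard (simp_all add: \<epsilon>_def)
  have \<epsilon>_inj: "f \<in> R \<Longrightarrow> \<epsilon> f = 0 \<Longrightarrow> f = 0" for f using transc by (simp add: R_def \<epsilon>_def)
  have X_k: "poly_over k [:0, 1:]"
    using subring_set_closed(1,2)[OF k(1)] by (auto simp: poly_over_def coeff_pCons split: nat.splits)
  have t0: "t \<noteq> 0"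
    using transc[OF X_k] by auto

  \<comment> \<open>Dividing by a power of the indeterminate keeps the degree least and makes the relation nonzero at \<open>T = 0\<close>.\<close>
  define good where "good = (\<lambda>q. poly_over R q \<and> q \<noteq> 0 \<and> poly (map_poly \<epsilon> q) y = 0)"
  obtain p0 where p0: "good p0" and min0: "\<And>q. good q \<Longrightarrow> degree p0 \<le> degree q"
    using ex_has_least_nat[of good q0 degree] alg by (auto simp: good_def R_def \<epsilon>_def)
  then obtain j p where jp: "p0 = smult ([:0, 1:] ^ j) p" "poly_over R p"
    "map_poly (\<lambda>f. poly f 0) p \<noteq> 0"
    using factor_out_indeterminate[OF k(1), of p0] unfolding good_def R_def by blast
  have "p \<noteq> 0" using jp(3) by auto
  have "\<epsilon> ([:0, 1:] ^ j) \<noteq> 0" using t0 by (simp add: \<epsilon>_def)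
  hence p: "poly_over R p" "p \<noteq> 0" "poly (map_poly \<epsilon> p) y = 0"
    using p0 jp \<open>p \<noteq> 0\<close> by (auto simp: good_def \<epsilon>.map_smult)
  have "degree p = degree p0" by (simp add: jp(1))
  hence min: "degree p \<le> degree q" if "poly_over R q" "q \<noteq> 0" "poly (map_poly \<epsilon> q) y = 0" for q
    using min0[of q] that by (simp add: good_def)
  have deg: "degree p > 0"
  proof (rule ccontr)
    assume "\<not> degree p > 0"
    then obtain a where "p = [:a:]" by (auto elim: degree_eq_zeroE)
    thus False using p \<epsilon>_inj[of a] by (auto simp: \<epsilon>.map_pCons poly_over_pCons)
  qed

  \<comment> \<open>Puiseux's theorem applies to \<open>p\<close> at \<open>T = X\<close>; its substitution \<open>X \<mapsto> X\<^sup>m\<close> gives \<open>T = X\<^sup>m\<close>.\<close>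
  interpret r1: idom_hom "ramified_eval 1 :: 'a poly \<Rightarrow> 'a fls" by (rule ramified_eval_hom)
  have "degree (map_poly (ramified_eval 1) p) = degree p"
    using \<open>p \<noteq> 0\<close> by (intro map_poly_degree_eq) (simp add: ramified_eval_props del: One_nat_def)
  then obtain m z where m: "m > 0"
    and z': "poly (map_poly (\<lambda>f. fls_compose_power f m) (map_poly (ramified_eval 1) p)) z = 0"
    using puiseux[OF char, of "map_poly (ramified_eval 1) p"] deg by auto
  define \<phi> :: "'a poly \<Rightarrow> 'a fls" where "\<phi> = ramified_eval m"
  interpret \<phi>: idom_hom \<phi> unfolding \<phi>_def by (rule ramified_eval_hom)
  have z: "poly (map_poly \<phi> p) z = 0"
  proof -
    have "(\<lambda>f. fls_compose_power (ramified_eval 1 f) m) = \<phi>"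
      unfolding \<phi>_def using ramified_eval_compose_power[OF m] by (intro ext) (rule sym)
    thus ?thesis
      using z' by (simp add: map_poly_map_poly o_def r1.hom_zero del: One_nat_def)
  qed
  have \<phi>_inj: "f \<in> R \<Longrightarrow> \<phi> f = 0 \<Longrightarrow> f = 0" for f
    by (simp add: \<phi>_def ramified_eval_props[OF m])
  have agree: "poly (map_poly \<epsilon> q) y = 0 \<longleftrightarrow> poly (map_poly \<phi> q) z = 0" if "poly_over R q" for q
    by (rule relations_agree[OF R \<epsilon>.idom_hom_axioms \<phi>.idom_hom_axioms _ _ p z _ that])
      (use \<epsilon>_inj \<phi>_inj min in blast)+
  have \<phi>_const: "\<phi> [:c:] = fls_const c" for c
    by (simp add: \<phi>_def ramified_eval_def map_poly_pCons)
  have \<phi>_X: "\<phi> [:0, 1:] = fls_X ^ m"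
    by (simp add: \<phi>_def ramified_eval_def map_poly_pCons)

  \<comment> \<open>\<open>g\<close> is the derivative that \<open>X\<close> must have for \<open>X\<^sup>m\<close> to satisfy the equation of \<open>t\<close>.\<close>
  define g where "g = fls_const (1 / of_nat m) * (fls_X * \<phi> h)"
  have \<phi>h: "fls_subdegree (\<phi> h) \<ge> 0" by (simp add: \<phi>_def ramified_eval_props[OF m])
  have Xh: "fls_subdegree (fls_X * \<phi> h) \<ge> 0" by (intro fls_mult_subdegree_ge_0 \<phi>h) simp
  have g: "fls_nth g 0 = 0" "fls_subdegree g \<ge> 0"
    using Xh \<phi>h unfolding g_def by (simp_all add: fls_nth_0_mult fls_mult_subdegree_ge_0)
  define \<Delta> where "\<Delta> = fls_derivation D g"
  have \<Delta>: "differential_field \<Delta>" unfolding \<Delta>_def by (rule differential_field_fls) (rule D)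
  interpret \<Delta>: derivation_along "\<lambda>x. x" \<Delta>
    using \<Delta> by (simp add: differential_field_derivation)
  have \<Delta>_const: "\<Delta> (fls_const c) = fls_const (D c)" for c
    unfolding \<Delta>_def by (rule fls_derivation_const[where d = D, OF D.der_zero])
  have of_nat_m: "(of_nat m :: 'a) \<noteq> 0" using m char by (simp add: of_nat_eq_0_char0)
  have \<Delta>_X: "\<Delta> (fls_X ^ m) = fls_X ^ m * \<phi> h"
  proof -
    have "\<Delta> (fls_X ^ m) = (fls_const (1 / of_nat m) * fls_const (of_nat m)) * (fls_X * fls_X ^ (m - 1)) * \<phi> h"
      unfolding \<Delta>_def fls_derivation_X_power[OF D] g_def by (simp add: fls_of_nat mult_ac)
    also have "fls_const (1 / of_nat m) * fls_const (of_nat m) = (1 :: 'a fls)"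
      using of_nat_m by (simp add: fls_const_mult_const)
    also have "fls_X * fls_X ^ (m - 1) = (fls_X :: 'a fls) ^ m" using m by (simp add: power_eq_if)
    finally show ?thesis by simp
  qed

  \<comment> \<open>\<open>\<delta>\<close> is the derivation of \<open>k[T]\<close> with \<open>T' = T h\<close>.\<close>
  define \<delta> where "\<delta> = (\<lambda>f. map_poly D f + pderiv f * ([:0, 1:] * h))"
  have \<delta>0: "\<delta> 0 = 0" by (simp add: \<delta>_def)
  have \<delta>_R: "\<delta> f \<in> R" if "f \<in> R" for f
  proof -
    have "poly_over k (map_poly D f)" using that k(2) by (intro poly_over_map[of D k]) (auto simp: D.der_zero R_def)
    thus ?thesis
      using that t(2) X_k unfolding \<delta>_def R_def mem_Collect_eq
      by (intro poly_over_closed[OF k(1)] poly_over_pderiv[OF k(1)])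
  qed
  have \<epsilon>_\<delta>: "D (\<epsilon> f) = \<epsilon> (\<delta> f)" for f
    using D.chain_rule[of f t] t(1) by (simp add: \<epsilon>_def \<delta>_def)
  have \<phi>_\<delta>: "\<Delta> (\<phi> f) = \<phi> (\<delta> f)" for f
  proof -
    interpret c: idom_hom "fls_const :: 'a \<Rightarrow> 'a fls" by (rule fls_const_hom)
    have "map_poly \<Delta> (map_poly fls_const f) = map_poly fls_const (map_poly D f)"
      by (rule poly_eqI)
        (simp add: coeff_map_poly \<Delta>.der_zero D.der_zero \<Delta>_const)
    hence "\<Delta> (\<phi> f) = \<phi> (map_poly D f) + \<phi> (pderiv f) * \<Delta> (fls_X ^ m)"
      using \<Delta>.chain_rule[of "map_poly fls_const f" "fls_X ^ m"]
      by (simp add: \<phi>_def ramified_eval_def c.map_pderiv)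
    thus ?thesis by (simp only: \<Delta>_X \<delta>_def \<phi>.hom_add \<phi>.hom_mult \<phi>_X)
  qed
  note D_eval = derivation_of_evaluation[OF D \<epsilon>.idom_hom_axioms \<epsilon>_\<delta> \<delta>0]
  note \<Delta>_eval = derivation_of_evaluation[OF \<Delta> \<phi>.idom_hom_axioms \<phi>_\<delta> \<delta>0]

  define P where "P = smult [:l:] (\<Prod>c\<in>S. [:- [:c:], 1:])"
  define q where "q = (map_poly \<delta> p)\<^sup>2 - P * (pderiv p)\<^sup>2"
  have const_R: "[:c:] \<in> R" if "c \<in> k" for c
    using that by (simp add: R_def poly_over_pCons) (simp add: poly_over_def subring_set_closed[OF k(1)])
  have P_R: "poly_over R P"
  proof -
    have "poly_over R (\<Prod>c\<in>A. [:- [:c:], 1:])" if "A \<subseteq> S" "finite A" for A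
      using that(2,1)
    proof (induction A)
      case (insert a A)
      have "[:a:] \<in> R" using insert.prems S(4) const_R by auto
      hence "- [:a:] \<in> R" by (rule subring_set_closed(6)[OF R])
      hence "poly_over R [:- [:a:], 1:]"
        by (simp only: poly_over_pCons) (simp add: subring_set_closed[OF R] poly_over_def)
      thus ?case using insert poly_over_closed(5)[OF R] by (simp del: mult_pCons_left)
    qed (simp add: poly_over_closed[OF R])
    thus ?thesis unfolding P_def using S(1) l(2)
      by (intro poly_over_smult[OF R] const_R) auto
  qed
  have d_R: "poly_over R (map_poly \<delta> p)"
    using p(1) \<delta>_R \<delta>0 by (intro poly_over_map[of \<delta> R])
  have q_R: "poly_over R q"
    unfolding q_def by (intro poly_over_closed[OF R] poly_over_power[OF R] P_R d_R poly_over_pderiv[OF R] p(1))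
  have P_\<epsilon>: "poly (map_poly \<epsilon> P) y = l * (\<Prod>c\<in>S. y - c)"
  proof -
    interpret E: idom_hom "\<lambda>p. poly (map_poly \<epsilon> p) y" by (rule \<epsilon>.eval_hom)
    show ?thesis unfolding P_def \<epsilon>.map_smult poly_smult E.hom_prod
      by (simp add: \<epsilon>.map_pCons \<epsilon>.homs) (simp add: \<epsilon>_def)
  qed
  have P_\<phi>: "poly (map_poly \<phi> P) z = fls_const l * (\<Prod>c\<in>S. z - fls_const c)"
  proof -
    interpret E: idom_hom "\<lambda>p. poly (map_poly \<phi> p) z" by (rule \<phi>.eval_hom)
    show ?thesis unfolding P_def \<phi>.map_smult poly_smult E.hom_prod
      by (simp add: \<phi>.map_pCons \<phi>.homs \<phi>_const)
  qed
  have D_y: "poly (map_poly \<epsilon> (map_poly \<delta> p)) y = - (poly (map_poly \<epsilon> (pderiv p)) y * D y)"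
    using D_eval[of p y] p(3) by (simp add: D.der_zero eq_neg_iff_add_eq_0)
  have \<Delta>_z: "poly (map_poly \<phi> (map_poly \<delta> p)) z = - (poly (map_poly \<phi> (pderiv p)) z * \<Delta> z)"
    using \<Delta>_eval[of p z] z by (simp add: \<Delta>.der_zero eq_neg_iff_add_eq_0)
  have "poly (map_poly \<epsilon> q) y = 0"
    by (simp add: q_def \<epsilon>.map_diff \<epsilon>.map_mult \<epsilon>.map_power D_y P_\<epsilon> sol(1)[symmetric] power_mult_distrib)
  hence qz: "poly (map_poly \<phi> q) z = 0" using agree[OF q_R] by simp
  have "CHAR('a poly) = 0" using char by simp
  hence "pderiv p \<noteq> 0" using deg by (intro pderiv_eq_0_char0)
  hence "poly (map_poly \<epsilon> (pderiv p)) y \<noteq> 0"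
    using min[of "pderiv p"] degree_pderiv_less[OF deg] poly_over_pderiv[OF R p(1)] by force
  hence sep: "poly (map_poly \<phi> (pderiv p)) z \<noteq> 0"
    using agree[OF poly_over_pderiv[OF R p(1)]] by simp
  have eq: "(\<Delta> z)\<^sup>2 = fls_const l * (\<Prod>c\<in>S. z - fls_const c)"
    using qz sep by (simp add: q_def \<phi>.map_diff \<phi>.map_mult \<phi>.map_power \<Delta>_z P_\<phi> power_mult_distrib
        mult.commute)
  have nz: "\<Delta> z \<noteq> 0"
  proof
    assume "\<Delta> z = 0"
    hence "poly (map_poly \<phi> P) z = 0" using eq P_\<phi> by simp
    hence "(D y)\<^sup>2 = 0" using agree[OF P_R] P_\<epsilon> sol(1) by simp
    thus False using sol(2) by simp
  qed
  note res = residue_of_local_solution[OF D g S(1-3) l(1) eq[unfolded \<Delta>_def] nz[unfolded \<Delta>_def]]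
  define a where "a = fls_nth z 0"
  show thesis
  proof (rule that)
    show "(D a)\<^sup>2 = l * (\<Prod>c\<in>S. a - c)" unfolding a_def by (rule res(2))
    moreover have "(\<Prod>c\<in>S. a - c) \<noteq> 0" using S(1) res(3) by (auto simp: a_def)
    ultimately show "D a \<noteq> 0" using l(1) by auto
    define r where "r = map_poly (\<lambda>f. poly f 0) p"
    show "r \<noteq> 0" unfolding r_def by (rule jp(3))
    show "poly_over k r"
      unfolding r_def using p(1) subring_set_closed[OF k(1)]
      by (intro poly_over_map[of _ R]) (auto simp: R_def poly_over_def poly_0_coeff_0)
    have "map_poly (\<lambda>f. fls_nth f 0) (map_poly \<phi> p) = r"
      unfolding r_def by (rule poly_eqI) (simp add: coeff_map_poly \<phi>.hom_zero \<phi>_def ramified_eval_props[OF m])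
    moreover have "fls_subdegree (coeff (map_poly \<phi> p) i) \<ge> 0" for i
      by (simp add: \<phi>.coeff_map) (simp add: \<phi>_def ramified_eval_props[OF m])
    ultimately show "poly r a = 0"
      using fls_nth_0_poly[OF res(1), of "map_poly \<phi> p"] z by (simp add: a_def)
  qed
qed


section \<open>Algebraic elements\<close>

text \<open>
  Transitivity of algebraicity is a dimension count, made for rings given as records with a carrier.
  The following lemmas identify that setting with a field type and its subfields.
\<close>

context
  fixes Rg :: "'a::field ring"
  defines Rg: "Rg \<equiv> ring_of_type_algebra"
begin

interpretation A: field Rg
  unfolding Rg by rule

lemma ring_of_type_simps:
  "carrier Rg = UNIV" "monoid.mult Rg x y = x * y" "add Rg x y = x + y" "one Rg = 1" "ring.zero Rg = 0"
  by (simp_all add: Rg ring_of_type_algebra_def)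

lemma ring_of_type_minus: "a_inv Rg x = - x"
proof -
  have "add Rg x (a_inv Rg x) = ring.zero Rg"
    by (rule A.r_neg) (simp add: ring_of_type_simps)
  thus ?thesis by (simp add: ring_of_type_simps eq_neg_iff_add_eq_0 add.commute)
qed

lemma ring_of_type_inverse: "x \<noteq> 0 \<Longrightarrow> m_inv Rg x = inverse x"
proof -
  assume "x \<noteq> 0"
  hence "x \<in> Units Rg" by (simp add: A.field_Units ring_of_type_simps)
  hence "monoid.mult Rg x (m_inv Rg x) = one Rg" by (rule A.Units_r_inv)
  thus "m_inv Rg x = inverse x" by (simp add: ring_of_type_simps inverse_unique)
qed

lemma ring_of_type_power: "x [^]\<^bsub>Rg\<^esub> (n::nat) = x ^ n"
  by (induction n) (simp_all add: ring_of_type_simps mult.commute)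

lemma eval_eq_poly: "A.eval xs x = poly (Poly (rev xs)) x"
  by (induction xs) (simp_all add: ring_of_type_simps ring_of_type_power Poly_append poly_monom mult.commute add.commute)

lemma subfield_iff: "subfield K Rg \<longleftrightarrow> is_subfield K"
proof
  assume K: "subfield K Rg"
  note s = subfieldE(1)[OF K]
  show "is_subfield K"
    unfolding is_subfield_def
  proof (intro conjI ballI)
    show "0 \<in> K" "1 \<in> K" using subringE(2,3)[OF s] by (simp_all add: ring_of_type_simps)
    fix x assume x: "x \<in> K"
    show "- x \<in> K" using subringE(5)[OF s x] by (simp add: ring_of_type_minus)
    show "inverse x \<in> K"
    proof (cases "x = 0")
      case False
      hence "m_inv Rg x \<in> K"
        using A.subfield_m_inv(1)[OF K] x by (simp add: ring_of_type_simps)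
      thus ?thesis using False by (simp add: ring_of_type_inverse)
    qed (use x in simp)
    fix y assume "y \<in> K"
    thus "x + y \<in> K" "x * y \<in> K"
      using subringE(6,7)[OF s x] by (simp_all add: ring_of_type_simps)
  qed
next
  assume K: "is_subfield K"
  show "subfield K Rg"
    by (rule A.subfieldI'[OF A.subringI])
      (use K in \<open>auto simp: is_subfield_def ring_of_type_simps ring_of_type_minus ring_of_type_inverse\<close>)
qed

lemma algebraic_iff:
  fixes K :: "'a set"
  assumes "is_subfield K"
  shows "(A.algebraic over K) x \<longleftrightarrow> algebraic_over K x"
proof
  assume *: "(A.algebraic over K) x"
  have K: "subring K Rg" using assms subfield_iff subfieldE(1) by blast
  obtain p where p: "p \<in> carrier (K[X]\<^bsub>Rg\<^esub>)" "p \<noteq> []" "A.eval p x = ring.zero Rg"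
    by (rule A.algebraicE[OF K _ *]) (simp add: ring_of_type_simps)
  have set: "set p \<subseteq> K" "hd p \<noteq> 0"
    using p(1,2) by (auto simp: univ_poly_def polynomial_def ring_of_type_simps)
  show "algebraic_over K x"
    unfolding algebraic_over_def
  proof (intro exI conjI allI)
    show "poly (Poly (rev p)) x = 0" using p(3) by (simp add: eval_eq_poly ring_of_type_simps)
    have "coeff (Poly (rev p)) (length p - 1) = hd p"
      using p(2) by (simp add: nth_default_def rev_nth hd_conv_nth)
    thus "Poly (rev p) \<noteq> 0" using set(2) by (metis coeff_0)
    have "set (rev p) \<subseteq> K" using set(1) by simp
    moreover have "0 \<in> K" using assms by (simp add: is_subfield_def)
    ultimately show "coeff (Poly (rev p)) i \<in> K" for i
      by (auto simp: nth_default_def) (metis length_rev nth_mem set_rev subsetD)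
  qed
next
  assume "algebraic_over K x"
  then obtain p where p: "p \<noteq> 0" "\<And>i. coeff p i \<in> K" "poly p x = 0"
    by (auto simp: algebraic_over_def)
  show "(A.algebraic over K) x"
  proof (rule A.algebraicI)
    have "set (coeffs p) \<subseteq> K" using p(2) by (auto simp: coeffs_def)
    thus "rev (coeffs p) \<in> carrier (K[X]\<^bsub>Rg\<^esub>)"
      using p(1) by (auto simp: univ_poly_def polynomial_def hd_rev last_coeffs_eq_coeff_degree ring_of_type_simps)
    show "rev (coeffs p) \<noteq> []" using p(1) by simp
    show "A.eval (rev (coeffs p)) x = ring.zero Rg"
      using p(3) by (simp add: eval_eq_poly ring_of_type_simps)
  qed
qed

lemma algebraic_elements_subfield:
  fixes K :: "'a set"
  assumes "is_subfield K"
  shows "is_subfield {x. algebraic_over K x}"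
  using A.subfield_of_algebraics[of K] assms
  by (simp add: subfield_iff algebraic_iff ring_of_type_simps)

text \<open>
  The coefficients of a relation for \<open>y\<close> generate a finite extension \<open>L\<close> of \<open>K\<close>, and adjoining \<open>y\<close> to
  \<open>L\<close> keeps the dimension over \<open>K\<close> finite.
\<close>

lemma algebraic_over_trans:
  fixes K :: "'a set"
  assumes K: "is_subfield K" and F: "\<And>x. x \<in> F \<Longrightarrow> algebraic_over K x" and y: "algebraic_over F y"
  shows "algebraic_over K y"
proof -
  obtain p where p: "p \<noteq> 0" "\<And>i. coeff p i \<in> F" "poly p y = 0"
    using y by (auto simp: algebraic_over_def)
  define xs where "xs = coeffs p"
  have K': "subfield K Rg" using K by (simp add: subfield_iff)
  have carr: "set xs \<subseteq> carrier Rg" "y \<in> carrier Rg" by (simp_all add: ring_of_type_simps)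
  have xs: "(A.algebraic over K) x" if "x \<in> set xs" for x
    using that F p(2) by (auto simp: xs_def coeffs_def algebraic_iff[OF K] split: if_splits)
  define L where "L = A.finite_extension K xs"
  have L: "subfield L Rg" unfolding L_def by (rule A.finite_extension_is_subfield[OF K' carr(1) xs])
  have L_fin: "A.finite_dimension K L"
    unfolding L_def by (rule A.finite_extension_finite_dimension(1)[OF K' carr(1) xs])
  have mem: "set xs \<subseteq> L"
    unfolding L_def by (rule A.finite_extension_mem[OF subfieldE(1)[OF K'] carr(1)])
  have "0 \<in> L" using L by (simp add: subfield_iff is_subfield_def)
  hence "coeff p i \<in> L" for i
    using mem p(1) by (cases "i \<le> degree p") (auto simp: xs_def coeff_eq_0 not_le intro: coeff_in_coeffs)
  hence "algebraic_over L y" using p by (auto simp: algebraic_over_def)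
  hence alg: "(A.algebraic over L) y" using L by (simp add: algebraic_iff subfield_iff)
  define M where "M = A.simple_extension L y"
  have "A.finite_dimension L M"
    unfolding M_def using A.finite_dimension_simple_extension[OF L carr(2)] alg by simp
  hence fin: "A.finite_dimension K M" by (rule A.telescopic_base_dim(1)[OF K' L L_fin])
  have "subring M Rg" unfolding M_def by (rule A.simple_extension_is_subring[OF subfieldE(1)[OF L] carr(2)])
  moreover have "y \<in> M" unfolding M_def by (rule A.simple_extension_mem[OF subfieldE(1)[OF L] carr(2)])
  ultimately have "(A.algebraic over K) y" using A.finite_dimension_imp_algebraic[OF K' _ fin] by blast
  thus ?thesis using K by (simp add: algebraic_iff)
qed

end

lemma is_subfield_adjoin: "is_subfield (adjoin K T)"
proof -
  have "is_subfield (\<Inter>F)" if "\<forall>L\<in>F. is_subfield L" for F :: "'a set set"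
    using that unfolding is_subfield_def by blast
  thus ?thesis unfolding adjoin_def by (rule hull_in)
qed

lemma adjoin_superset: "K \<subseteq> adjoin K T" "T \<subseteq> adjoin K T"
  unfolding adjoin_def using hull_subset[of "K \<union> T" is_subfield] by auto

lemma adjoin_least: "is_subfield L \<Longrightarrow> K \<subseteq> L \<Longrightarrow> T \<subseteq> L \<Longrightarrow> adjoin K T \<subseteq> L"
  unfolding adjoin_def by (rule hull_minimal) auto

lemma algebraic_over_self:
  assumes "is_subfield K" "x \<in> K"
  shows "algebraic_over K x"
  unfolding algebraic_over_def
  by (rule exI[of _ "[:- x, 1:]"]) (use assms in \<open>auto simp: is_subfield_def coeff_pCons split: nat.splits\<close>)

lemma algebraic_over_adjoin_algebraic:
  assumes K: "is_subfield K" and t: "algebraic_over K t" and y: "algebraic_over (adjoin K {t}) y"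
  shows "algebraic_over K y"
proof (rule algebraic_over_trans[OF K _ y])
  have "adjoin K {t} \<subseteq> {x. algebraic_over K x}"
    by (rule adjoin_least[OF algebraic_elements_subfield[OF K]]) (use t algebraic_over_self[OF K] in auto)
  thus "x \<in> adjoin K {t} \<Longrightarrow> algebraic_over K x" for x by blast
qed


section \<open>Descending a Liouvillian tower\<close>

lemma is_subfield_subring: "is_subfield K \<Longrightarrow> subring_set K"
  unfolding is_subfield_def subring_set_def by (metis diff_conv_add_uminus)

lemma adjoin_subset_fractions:
  assumes K: "is_subfield K"
  shows "adjoin K {t} \<subseteq> {poly f t / poly g t | f g. poly_over K f \<and> poly_over K g \<and> poly g t \<noteq> 0}"
    (is "_ \<subseteq> ?L")
proof (rule adjoin_least)
  note R = is_subfield_subring[OF K]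
  note cl = poly_over_closed[OF R]
  have X: "poly_over K [:0, 1:]" and const: "c \<in> K \<Longrightarrow> poly_over K [:c:]" for c
    using subring_set_closed(1,2)[OF R] by (auto simp: poly_over_def coeff_pCons split: nat.splits)
  have L: "x \<in> ?L" if "x = poly f t / poly g t" "poly_over K f" "poly_over K g" "poly g t \<noteq> 0" for x f g
    using that by blast
  show "K \<subseteq> ?L"
  proof
    fix c assume "c \<in> K"
    thus "c \<in> ?L" by (intro L[of c "[:c:]" 1] const cl) simp_all
  qed
  show "{t} \<subseteq> ?L" using L[of t "[:0, 1:]" 1] X cl by simp
  show "is_subfield ?L"
    unfolding is_subfield_def
  proof (intro conjI ballI)
    show "0 \<in> ?L" "1 \<in> ?L" using L[of 0 0 1] L[of 1 1 1] cl by simp_all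
    fix x assume "x \<in> ?L"
    then obtain f g where x: "x = poly f t / poly g t" "poly_over K f" "poly_over K g" "poly g t \<noteq> 0" by blast
    show "- x \<in> ?L" using x by (intro L[of "- x" "- f" g] cl) simp_all
    show "inverse x \<in> ?L"
    proof (cases "poly f t = 0")
      case True
      thus ?thesis using \<open>0 \<in> ?L\<close> x by simp
    qed (use x in \<open>intro L[of "inverse x" g f]; simp\<close>)
    fix y assume "y \<in> ?L"
    then obtain f' g' where y: "y = poly f' t / poly g' t" "poly_over K f'" "poly_over K g'" "poly g' t \<noteq> 0" by blast
    show "x + y \<in> ?L" using x y
      by (intro L[of "x + y" "f * g' + f' * g" "g * g'"] cl) (simp_all add: add_frac_eq)
    show "x * y \<in> ?L" using x y
      by (intro L[of "x * y" "f * f'" "g * g'"] cl) simp_all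
  qed
qed

lemma clear_denominators:
  assumes K: "is_subfield K" and y: "algebraic_over (adjoin K {t}) y"
  obtains q where "poly_over {f. poly_over K f} q" "map_poly (\<lambda>f. poly f t) q \<noteq> 0"
    "poly (map_poly (\<lambda>f. poly f t) q) y = 0"
proof -
  note R = is_subfield_subring[OF K]
  note cl = poly_over_closed[OF R]
  obtain p where p: "p \<noteq> 0" "\<And>i. coeff p i \<in> adjoin K {t}" "poly p y = 0"
    using y by (auto simp: algebraic_over_def)
  have "\<forall>i. \<exists>f g. coeff p i = poly f t / poly g t \<and> poly_over K f \<and> poly_over K g \<and> poly g t \<noteq> 0"
    using p(2) adjoin_subset_fractions[OF K, of t] by blast
  then obtain f g where fg: "\<And>i. coeff p i = poly (f i) t / poly (g i) t"
    "\<And>i. poly_over K (f i)" "\<And>i. poly_over K (g i)" "\<And>i. poly (g i) t \<noteq> 0" by metis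
  define n where "n = degree p"
  define G where "G = (\<Prod>i\<le>n. g i)"
  define a where "a = (\<lambda>i. f i * (\<Prod>j\<in>{..n} - {i}. g j))"
  define q where "q = (\<Sum>i\<le>n. monom (a i) i)"
  have prod_over: "poly_over K (\<Prod>j\<in>A. g j)" for A
    by (induction A rule: infinite_finite_induct) (simp_all add: cl fg)
  have coeff_q: "coeff q i = (if i \<le> n then a i else 0)" for i
    by (simp add: q_def coeff_sum coeff_monom)
  have G: "poly G t \<noteq> 0" by (simp add: G_def poly_prod fg)
  have "poly (a i) t = poly G t * coeff p i" if "i \<le> n" for i
  proof -
    have "poly G t = poly (g i) t * poly (\<Prod>j\<in>{..n} - {i}. g j) t"
      using that by (simp add: G_def prod.remove[of "{..n}" i])
    thus ?thesis using fg(4)[of i] by (simp add: a_def fg(1) field_simps)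
  qed
  hence q_p: "map_poly (\<lambda>f. poly f t) q = smult (poly G t) p"
    by (intro poly_eqI) (auto simp: coeff_map_poly coeff_q n_def coeff_eq_0)
  show thesis
  proof (rule that)
    show "poly_over {f. poly_over K f} q"
      by (simp add: poly_over_def[of "{f. poly_over K f}"] coeff_q a_def cl fg prod_over)
    show "map_poly (\<lambda>f. poly f t) q \<noteq> 0" "poly (map_poly (\<lambda>f. poly f t) q) y = 0"
      using G p by (simp_all add: q_p)
  qed
qed

lemma algebraic_over_iff_poly_over:
  "algebraic_over K x \<longleftrightarrow> (\<exists>p. p \<noteq> 0 \<and> poly_over K p \<and> poly p x = 0)"
  by (simp add: algebraic_over_def poly_over_def)

lemma algebraic_over_mono: "algebraic_over K x \<Longrightarrow> K \<subseteq> L \<Longrightarrow> algebraic_over L x"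
  unfolding algebraic_over_def by blast

text \<open>
  A primitive generator is exchanged for its inverse, so that in both transcendental cases the
  derivative of the generator \<open>u\<close> is divisible by \<open>u\<close>.
\<close>

lemma solution_descends_one_step:
  fixes D :: "'a::alg_closed_field \<Rightarrow> 'a"
  assumes D: "differential_field D" and char: "CHAR('a) = 0"
    and k: "is_differential_subfield D k"
    and t: "D t \<in> k \<or> t \<noteq> 0 \<and> D t / t \<in> k \<or> algebraic_over k t"
    and S: "finite S" "card S \<ge> 3" "\<And>c. c \<in> S \<Longrightarrow> D c = 0" "S \<subseteq> k" and l: "l \<noteq> 0" "l \<in> k"
    and sol: "(D y)\<^sup>2 = l * (\<Prod>c\<in>S. y - c)" "D y \<noteq> 0"
    and y: "algebraic_over (adjoin k {t}) y"
  shows "\<exists>a. algebraic_over k a \<and> (D a)\<^sup>2 = l * (\<Prod>c\<in>S. a - c) \<and> D a \<noteq> 0"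
proof (cases "algebraic_over k t")
  case True
  thus ?thesis
    using algebraic_over_adjoin_algebraic[OF _ True y] k sol by (auto simp: is_differential_subfield_def)
next
  case False
  interpret D: derivation_along "\<lambda>x. x" D
    using D by (simp add: differential_field_derivation)
  have K: "is_subfield k" and Dk: "\<And>x. x \<in> k \<Longrightarrow> D x \<in> k"
    using k by (auto simp: is_differential_subfield_def)
  note R = is_subfield_subring[OF K]
  have t0: "t \<noteq> 0" using False algebraic_over_self[OF K, of 0] K by (auto simp: is_subfield_def)
  have "\<exists>u h. u \<noteq> 0 \<and> \<not> algebraic_over k u \<and> t \<in> adjoin k {u} \<and> D u = u * poly h u \<and> poly_over k h"
  proof (cases "D t / t \<in> k")
    case True
    have "poly_over k [:D t / t:]"
      using True subring_set_closed(1)[OF R] by (auto simp: poly_over_def coeff_pCons split: nat.splits)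
    thus ?thesis using False t0 adjoin_superset(2)[of "{t}" k]
      by (intro exI[of _ t] exI[of _ "[:D t / t:]"]) simp
  next
    case nt: False
    define u where "u = inverse t"
    have Dt: "D t \<in> k" using t nt False by blast
    have u: "u \<noteq> 0" "t = inverse u" using t0 by (simp_all add: u_def)
    have sub: "is_subfield {x. algebraic_over k x}" by (rule algebraic_elements_subfield[OF K])
    have "\<not> algebraic_over k u"
      using sub False u(2) by (auto simp: is_subfield_def)
    moreover have "t \<in> adjoin k {u}"
      using is_subfield_adjoin[of k "{u}"] adjoin_superset(2)[of "{u}" k] by (simp add: u(2) is_subfield_def)
    moreover have "D u = u * poly [:0, - D t:] u"
    proof -
      have "D (t * u) = 0" using t0 by (simp add: u_def D.der_one)
      hence "t * D u = - (D t * u)" by (simp add: D.der_mult eq_neg_iff_add_eq_0 add.commute)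
      hence "D u = - (D t * u) * u" using t0 by (simp add: u_def field_simps)
      thus ?thesis by (simp add: mult_ac)
    qed
    moreover have "poly_over k [:0, - D t:]"
      using Dt subring_set_closed(1,6)[OF R] by (auto simp: poly_over_def coeff_pCons split: nat.splits)
    ultimately show ?thesis using u(1) by blast
  qed
  then obtain u h where u: "\<not> algebraic_over k u" "t \<in> adjoin k {u}" "D u = u * poly h u" "poly_over k h"
    by blast
  have transc: "f = 0" if "poly_over k f" "poly f u = 0" for f
    using u(1) that by (auto simp: algebraic_over_iff_poly_over)
  have "adjoin k {t} \<subseteq> adjoin k {u}"
    using u(2) by (intro adjoin_least is_subfield_adjoin adjoin_superset) simp
  with y have "algebraic_over (adjoin k {u}) y" by (rule algebraic_over_mono)
  then obtain q where q: "poly_over {f. poly_over k f} q" "map_poly (\<lambda>f. poly f u) q \<noteq> 0"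
    "poly (map_poly (\<lambda>f. poly f u) q) y = 0"
    by (rule clear_denominators[OF K])
  have "q \<noteq> 0" using q(2) by auto
  obtain p a where "poly_over k p" "p \<noteq> 0" "poly p a = 0" "(D a)\<^sup>2 = l * (\<Prod>c\<in>S. a - c)" "D a \<noteq> 0"
    by (rule solution_specialises[OF D char R Dk u(3,4) transc S l sol q(1) \<open>q \<noteq> 0\<close> q(3)])
  thus ?thesis by (auto simp: algebraic_over_iff_poly_over)
qed


lemma rsquarefree_imp_prod_roots:
  fixes P :: "'c::alg_closed_field poly"
  assumes "rsquarefree P"
  obtains S where "finite S" "card S = degree P" "P = smult (lead_coeff P) (\<Prod>c\<in>S. [:- c, 1:])"
proof -
  have "P \<noteq> 0" using assms by (simp add: rsquarefree_def)
  then obtain A where A: "size A = degree P" "P = smult (lead_coeff P) (\<Prod>x\<in>#A. [:- x, 1:])"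
    using alg_closed_imp_factorization by blast
  have le1: "count A x \<le> 1" for x
  proof (rule ccontr)
    assume "\<not> count A x \<le> 1"
    then obtain B where B: "A = add_mset x (add_mset x B)"
      by (metis One_nat_def count_add_mset count_eq_zero_iff insert_DiffM not_less_eq_eq le0 multi_member_split)
    have "(\<Prod>x\<in>#A. [:- x, 1:]) = [:- x, 1:] ^ 2 * (\<Prod>x\<in>#B. [:- x, 1:])"
      by (simp only: B image_mset_add_mset prod_mset.add_mset power2_eq_square mult.assoc)
    hence "[:- x, 1:] ^ 2 dvd P"
      by (subst A(2)) (simp only: dvd_smult dvd_triv_left)
    hence "2 \<le> order x P" using \<open>P \<noteq> 0\<close> by (simp only: order_divides simp_thms)
    moreover have "order x P \<le> 1" using assms by (auto simp: rsquarefree_def dest: spec[of _ x])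
    ultimately show False by simp
  qed
  have "A = mset_set (set_mset A)"
  proof (rule multiset_eqI)
    fix x
    show "count A x = count (mset_set (set_mset A)) x"
    proof (cases "x \<in># A")
      case True
      hence "count A x = 1" using le1[of x] count_greater_zero_iff[of A x] by linarith
      thus ?thesis using True by simp
    qed (simp add: not_in_iff)
  qed
  then obtain S where S: "finite S" "A = mset_set S" by blast
  show thesis
  proof (rule that[OF S(1)])
    show "card S = degree P" using A(1) S by simp
    show "P = smult (lead_coeff P) (\<Prod>c\<in>S. [:- c, 1:])"
      using A(2) S by (simp add: prod_unfold_prod_mset)
  qed
qed

lemma root_in_range_of_alg_closed:
  fixes h :: "'r::alg_closed_field \<Rightarrow> 's::idom"
  assumes "idom_hom h" and inj: "\<And>x. h x = 0 \<Longrightarrow> x = 0"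
    and p: "p \<noteq> 0" "poly (map_poly h p) a = 0"
  shows "a \<in> range h"
proof -
  interpret idom_hom h by fact
  obtain A where A: "p = smult (lead_coeff p) (\<Prod>x\<in>#A. [:- x, 1:])"
    using alg_closed_imp_factorization[OF p(1)] by blast
  have "h (lead_coeff p) \<noteq> 0" using inj[of "lead_coeff p"] p(1) by auto
  moreover have "h (lead_coeff p) * poly (map_poly h (\<Prod>x\<in>#A. [:- x, 1:])) a = 0"
    using arg_cong[OF A, of "\<lambda>p. poly (map_poly h p) a"] p(2) by (simp only: map_smult poly_smult)
  ultimately have "poly (map_poly h (\<Prod>x\<in>#A. [:- x, 1:])) a = 0" by simp
  hence "\<exists>x\<in>#A. a = h x"
  proof (induction A)
    case (add b A)
    have "poly (map_poly h [:- b, 1:]) a = a - h b" by (simp add: map_pCons homs)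
    moreover have "poly (map_poly h [:- b, 1:]) a * poly (map_poly h (\<Prod>x\<in>#A. [:- x, 1:])) a = 0"
      using add.prems by (simp only: image_mset_add_mset prod_mset.add_mset map_mult poly_mult)
    ultimately show ?case using add.IH by auto
  qed (simp add: map_poly_1 hom_one)
  thus ?thesis by blast
qed

text \<open>
  The tower is moved into the algebraic closure and the solution is carried down to its bottom field.
  There it is algebraic over the image of \<open>C\<close>, hence a constant.
\<close>

theorem no_liouvillian_solution:
  fixes dC :: "'c::{alg_closed_field, field_char_0} \<Rightarrow> 'c"
    and dF :: "'f::field \<Rightarrow> 'f"
    and \<iota> :: "'c \<Rightarrow> 'f"
  assumes ext: "differential_field_extension dC dF \<iota>"
    and trivial: "\<And>c. dC c = 0"
    and P: "3 \<le> degree P" "rsquarefree P"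
    and y: "(dF y)\<^sup>2 = poly (map_poly \<iota> P) y" "dF y \<noteq> 0"
  shows "\<not> liouvillian_over dF (range \<iota>) y"
proof
  assume "liouvillian_over dF (range \<iota>) y"
  then obtain E where "liouvillian_extension dF (range \<iota>) E" and yE: "y \<in> E"
    unfolding liouvillian_over_def by blast
  define is_tower where "is_tower = (\<lambda>(n::nat) t k.
    E = adjoin (range \<iota>) (t ` {1..n}) \<and> k 0 = range \<iota> \<and> k n = E \<and>
    (\<forall>i\<le>n. is_differential_subfield dF (k i)) \<and>
    (\<forall>i\<in>{1..n}. k i = adjoin (k (i - 1)) {t i} \<and>
      (dF (t i) \<in> k (i - 1) \<or> t i \<noteq> 0 \<and> dF (t i) / t i \<in> k (i - 1) \<or>
       algebraic_over (k (i - 1)) (t i))))"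
  have "\<exists>n t k. is_tower n t k"
    using \<open>liouvillian_extension dF (range \<iota>) E\<close>
    unfolding liouvillian_extension_def is_tower_def by simp
  then obtain n t k where steps: "is_tower n t k" by blast
  have tower: "k 0 = range \<iota>" "y \<in> k n"
    "\<And>i. i \<le> n \<Longrightarrow> is_differential_subfield dF (k i)"
    "\<And>i. i \<in> {1..n} \<Longrightarrow> k i = adjoin (k (i - 1)) {t i}"
    "\<And>i. i \<in> {1..n} \<Longrightarrow> dF (t i) \<in> k (i - 1) \<or> t i \<noteq> 0 \<and> dF (t i) / t i \<in> k (i - 1) \<or>
       algebraic_over (k (i - 1)) (t i)"
    using steps yE by (auto simp: is_tower_def)
  interpret ext: differential_field_extension dC dF \<iota> by (rule ext)
  interpret \<iota>: idom_hom \<iota> by standard (rule ext.embed_one ext.embed_add ext.embed_mult)+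
  have \<iota>_inj: "\<iota> c = 0 \<Longrightarrow> c = 0" for c
    using \<iota>.hom_mult[of c "inverse c"] \<iota>.hom_one by (cases "c = 0") auto
  have "CHAR('f) = 0"
  proof (rule CHAR_eqI)
    show "0 dvd m" if "of_nat m = (0 :: 'f)" for m
      using that \<iota>_inj[of "of_nat m"] by (simp add: \<iota>.hom_of_nat)
  qed simp
  then obtain D :: "'f alg_closure \<Rightarrow> 'f alg_closure" where
    D: "differential_field D" and D_ac: "\<And>a. D (to_ac a) = to_ac (dF a)"
    using derivation_extends_to_alg_closure[OF ext.ext.differential_field_axioms] by metis
  have char: "CHAR('f alg_closure) = 0" using \<open>CHAR('f) = 0\<close> by simp
  define \<kappa> where "\<kappa> = (\<lambda>c. to_ac (\<iota> c))"
  interpret ac: idom_hom "to_ac :: 'f \<Rightarrow> 'f alg_closure" by (rule to_ac_hom)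
  interpret \<kappa>: idom_hom \<kappa>
    unfolding \<kappa>_def by (rule idom_hom_comp) (rule ac.idom_hom_axioms \<iota>.idom_hom_axioms)+
  have \<kappa>_inj: "\<kappa> c = 0 \<Longrightarrow> c = 0" for c using \<iota>_inj by (simp add: \<kappa>_def)
  hence inj: "inj \<kappa>" by (intro injI) (metis \<kappa>.hom_diff right_minus_eq)
  have D_\<kappa>: "D (\<kappa> c) = 0" for c
    by (simp add: \<kappa>_def D_ac ext.embed_deriv[symmetric] trivial \<iota>.hom_zero)

  obtain S0 where S0: "finite S0" "card S0 = degree P" "P = smult (lead_coeff P) (\<Prod>c\<in>S0. [:- c, 1:])"
    by (rule rsquarefree_imp_prod_roots[OF P(2)])
  define S where "S = \<kappa> ` S0"
  define l where "l = \<kappa> (lead_coeff P)"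
  have "P \<noteq> 0" using P(1) by auto
  hence l0: "l \<noteq> 0" using \<kappa>_inj[of "lead_coeff P"] by (auto simp: l_def)
  have S: "finite S" "card S \<ge> 3" "\<And>c. c \<in> S \<Longrightarrow> D c = 0"
    using S0 P(1) inj by (auto simp: S_def card_image inj_on_subset D_\<kappa>)
  define solution where "solution = (\<lambda>a. (D a)\<^sup>2 = l * (\<Prod>c\<in>S. a - c) \<and> D a \<noteq> 0)"
  have "solution (to_ac y)"
  proof -
    interpret E: idom_hom "\<lambda>p. poly (map_poly \<kappa> p) (to_ac y)" by (rule \<kappa>.eval_hom)
    have "(D (to_ac y))\<^sup>2 = to_ac (poly (map_poly \<iota> P) y)"
      by (simp only: D_ac y(1)[symmetric] to_ac_power)
    also have "\<dots> = poly (map_poly \<kappa> P) (to_ac y)"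
      by (simp add: ac.poly_map[symmetric] map_poly_map_poly o_def \<iota>.hom_zero \<kappa>_def)
    also have "\<dots> = l * (\<Prod>c\<in>S0. to_ac y - \<kappa> c)"
      by (subst S0(3)) (simp only: \<kappa>.map_smult poly_smult E.hom_prod,
        simp add: \<kappa>.map_pCons \<kappa>.homs l_def)
    also have "(\<Prod>c\<in>S0. to_ac y - \<kappa> c) = (\<Prod>c\<in>S. to_ac y - c)"
      using inj by (simp add: S_def prod.reindex inj_on_subset)
    finally show ?thesis using y(2) by (simp add: solution_def D_ac)
  qed

  define k' where "k' = (\<lambda>i. to_ac ` k i)"
  have subfield_image: "is_subfield (to_ac ` K)" if "is_subfield K" for K :: "'f set"
    using that unfolding is_subfield_def
    by (auto simp flip: to_ac_add to_ac_mult to_ac_minus to_ac_inverse intro: image_eqI[of 0] image_eqI[of 1])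
  have k': "is_differential_subfield D (k' i)" if "i \<le> n" for i
    using tower(3)[OF that] subfield_image[of "k i"]
    by (auto simp: is_differential_subfield_def k'_def D_ac)
  have adjoin_image: "to_ac ` adjoin K {x} \<subseteq> adjoin (to_ac ` K) {to_ac x}" for K :: "'f set" and x
  proof -
    have "is_subfield (to_ac -` adjoin (to_ac ` K) {to_ac x})"
      using is_subfield_adjoin[of "to_ac ` K" "{to_ac x}"] by (simp add: is_subfield_def)
    hence "adjoin K {x} \<subseteq> to_ac -` adjoin (to_ac ` K) {to_ac x}"
      using adjoin_superset(1)[of "to_ac ` K" "{to_ac x}"] adjoin_superset(2)[of "{to_ac x}" "to_ac ` K"]
      by (intro adjoin_least) auto
    thus ?thesis by blast
  qed
  have alg_image: "algebraic_over (to_ac ` K) (to_ac x)" if alg: "algebraic_over K x" for K :: "'f set" and x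
  proof -
    obtain p where p: "p \<noteq> 0" "\<And>i. coeff p i \<in> K" "poly p x = 0"
      using alg by (auto simp: algebraic_over_def)
    thus ?thesis unfolding algebraic_over_def
      by (intro exI[of _ "map_poly to_ac p"]) (simp add: ac.coeff_map ac.poly_map map_poly_eq_0_iff)
  qed
  have const: "range \<kappa> \<subseteq> k' i" if "i \<le> n" for i
    using that
  proof (induction i)
    case (Suc i)
    have "k i \<subseteq> k (Suc i)"
      using tower(4)[of "Suc i"] Suc.prems adjoin_superset(1)[of "k i" "{t (Suc i)}"] by simp
    hence "k' i \<subseteq> k' (Suc i)" by (auto simp: k'_def)
    thus ?case using Suc by simp
  qed (auto simp: k'_def tower(1) \<kappa>_def)
  have descent: "\<exists>a. algebraic_over (k' (n - j)) a \<and> solution a" if "j \<le> n" for j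
    using that
  proof (induction j)
    case 0
    have "is_subfield (k' n)" using k'[of n] by (simp add: is_differential_subfield_def)
    moreover have "to_ac y \<in> k' n" using tower(2) by (simp add: k'_def)
    ultimately show ?case using \<open>solution (to_ac y)\<close> algebraic_over_self by auto
  next
    case (Suc j)
    define i where "i = n - Suc j"
    have i: "Suc i \<in> {1..n}" "n - j = Suc i" "i \<le> n" using Suc.prems by (auto simp: i_def)
    obtain b where b: "algebraic_over (k' (Suc i)) b" "solution b" using Suc i(2) by auto
    have "k' (Suc i) \<subseteq> adjoin (k' i) {to_ac (t (Suc i))}"
      using adjoin_image[of "k i" "t (Suc i)"] tower(4)[OF i(1)] by (simp add: k'_def)
    with b(1) have b': "algebraic_over (adjoin (k' i) {to_ac (t (Suc i))}) b"
      by (rule algebraic_over_mono)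
    have step: "D (to_ac (t (Suc i))) \<in> k' i \<or>
        to_ac (t (Suc i)) \<noteq> 0 \<and> D (to_ac (t (Suc i))) / to_ac (t (Suc i)) \<in> k' i \<or>
        algebraic_over (k' i) (to_ac (t (Suc i)))"
      using tower(5)[OF i(1)] alg_image[of "k i"] by (auto simp: k'_def D_ac simp flip: to_ac_divide)
    have "S \<subseteq> k' i" "l \<in> k' i" using const[OF i(3)] by (auto simp: S_def l_def)
    thus ?case
      using solution_descends_one_step[OF D char k'[OF i(3)] step S _ l0 _ _ _ b'] b(2)
      by (auto simp: solution_def i_def)
  qed
  obtain a where a: "algebraic_over (range \<kappa>) a" "solution a"
    using descent[of n] tower(1) by (auto simp: k'_def \<kappa>_def image_image)
  have "\<exists>p. p \<noteq> 0 \<and> poly (map_poly \<kappa> p) a = 0"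
  proof -
    obtain p where p: "p \<noteq> 0" "\<And>i. coeff p i \<in> range \<kappa>" "poly p a = 0"
      using a(1) by (auto simp: algebraic_over_def)
    define p' where "p' = map_poly (inv_into UNIV \<kappa>) p"
    have "inv_into UNIV \<kappa> 0 = 0" using inj \<kappa>.hom_zero by (metis inv_f_f)
    hence "map_poly \<kappa> p' = p"
      using p(2) by (intro poly_eqI) (simp add: \<kappa>.coeff_map p'_def coeff_map_poly f_inv_into_f)
    thus ?thesis using p by (intro exI[of _ p']) auto
  qed
  hence "a \<in> range \<kappa>"
    using root_in_range_of_alg_closed[OF \<kappa>.idom_hom_axioms \<kappa>_inj] by blast
  thus False using a(2) D_\<kappa> by (auto simp: solution_def)
qed

theorem proposition3p2:
  fixes dC :: "'c::{alg_closed_field, field_char_0} \<Rightarrow> 'c"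
    and dF :: "'f::field \<Rightarrow> 'f"
    and \<iota> :: "'c \<Rightarrow> 'f"
  assumes ext: "differential_field_extension dC dF \<iota>"
    and trivial: "\<And>c. dC c = 0"
  shows "(\<forall>P :: 'c poly. 3 \<le> degree P \<longrightarrow> rsquarefree P \<longrightarrow>
            \<not> (\<exists>y. (dF y)\<^sup>2 = poly (map_poly \<iota> P) y \<and> dF y \<noteq> 0 \<and>
                   liouvillian_over dF (range \<iota>) y)) \<and>
         (\<forall>a b :: 'c. a ^ 3 / 27 + b\<^sup>2 / 4 \<noteq> 0 \<longrightarrow>
            (\<forall>y. dF y \<noteq> 0 \<longrightarrow> (dF y)\<^sup>2 = y ^ 3 + \<iota> a * y + \<iota> b \<longrightarrow>
                 \<not> liouvillian_over dF (range \<iota>) y))"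
proof (intro conjI allI impI)
  show "\<not> (\<exists>y. (dF y)\<^sup>2 = poly (map_poly \<iota> P) y \<and> dF y \<noteq> 0 \<and> liouvillian_over dF (range \<iota>) y)"
    if "3 \<le> degree P" "rsquarefree P" for P :: "'c poly"
    using no_liouvillian_solution[OF ext trivial that] by blast
next
  fix a b :: 'c and y
  assume disc: "a ^ 3 / 27 + b\<^sup>2 / 4 \<noteq> 0" and y: "dF y \<noteq> 0" "(dF y)\<^sup>2 = y ^ 3 + \<iota> a * y + \<iota> b"
  interpret ext: differential_field_extension dC dF \<iota> by (rule ext)
  interpret \<iota>: idom_hom \<iota> by standard (rule ext.embed_one ext.embed_add ext.embed_mult)+
  define P :: "'c poly" where "P = [:b, a, 0, 1:]"
  have "rsquarefree P"
    unfolding rsquarefree_roots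
  proof (rule allI, rule notI)
    fix r assume "poly P r = 0 \<and> poly (pderiv P) r = 0"
    \<comment> \<open>A double root \<open>r\<close> makes \<open>a\<^sup>3 / 27 = - r\<^sup>6\<close> and \<open>b\<^sup>2 / 4 = r\<^sup>6\<close>.\<close>
    hence "a = - 3 * r\<^sup>2" "b = - (r ^ 3) - a * r"
      by (simp_all add: P_def pderiv_pCons eq_neg_iff_add_eq_0 power2_eq_square power3_eq_cube algebra_simps)
    hence "a ^ 3 / 27 + b\<^sup>2 / 4 = 0"
      by (simp add: field_simps power2_eq_square power3_eq_cube)
    thus False using disc by simp
  qed
  moreover have "poly (map_poly \<iota> P) y = y ^ 3 + \<iota> a * y + \<iota> b"
    by (simp add: P_def \<iota>.map_pCons \<iota>.homs power3_eq_cube algebra_simps)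
  ultimately show "\<not> liouvillian_over dF (range \<iota>) y"
    using no_liouvillian_solution[OF ext trivial, of P y] y by (simp add: P_def)
qed

end
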